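(* Let $F$ be a perfect field and $d\in W(F)$. There exists a unique sequence of abelian groups $Q_{d,k}$ and of elements $\Sigma_k(d)\in Q_{d,k}$, where $k$ ranges over the nonnegative even integers, such that: (i) $Q_{d,0}=W(F)$ and $\Sigma_0(d)=1\in Q_{d,0}$; (ii) for each positive even integer $k$, $Q_{d,k}$ is the quotient group $Q_{d,k-2}/(\Sigma_{k-2}(d))$; (iii) for each positive even integer $k$, as soon as $n\in\mathbb{N}_0$ and $a_1,\dots,a_n\in F^*$ satisfy $\sum_{i=1}^n\langle a_i\rangle=d\in W(F)$, we have $$\Sigma_k(d)=\sum_{1\leq i_1<\dots<i_k\leq n}\Big\langle\prod_{1\leq j\leq k}a_{i_j}\Big\rangle\in Q_{d,k}.$$
   Context: $W(F)$ is the Witt ring of the field $F$ (symmetric bilinear forms); for $a\in F^*$, $\langle a\rangle\in W(F)$ is the class of the rank one form with coefficient $a$, and $1=\langle 1\rangle$. As an abelian group $W(F)$ is presented by generators $\langle a\rangle$ ($a\in F^*$) and relations $\langle ab^2\rangle=\langle a\rangle$; $\langle a\rangle+\langle b\rangle=\langle a+b\rangle+\langle(a+b)ab\rangle$ if $a+b\neq 0$; $\langle 1\rangle+\langle -1\rangle=0$. $(\Sigma_{k-2}(d))$ denotes the subgroup of $Q_{d,k-2}$ generated by $\Sigma_{k-2}(d)$. Each $Q_{d,k}$ is an iterated quotient of $W(F)$, and the right-hand side in (iii) means the image in $Q_{d,k}$ of the corresponding element of $W(F)$ (an empty sum is $0$). *)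

theory Defs
  imports "HOL-Algebra.Algebra" "Jordan_Normal_Form.Matrix"
begin

definition perfect_field :: "'a::field itself \<Rightarrow> bool" where
  "perfect_field _ \<longleftrightarrow> CHAR('a) = 0 \<or> surj (\<lambda>x::'a. x ^ CHAR('a))"

text \<open>
  A nondegenerate symmetric bilinear form on \<open>F\<^sup>n\<close> is given by its Gram matrix.  No assumption is
  made on the characteristic.
\<close>

definition sym_forms :: "'a::field mat set" where
  "sym_forms = {A. invertible_mat A \<and> transpose_mat A = A}"

definition isometric :: "'a::field mat \<Rightarrow> 'a mat \<Rightarrow> bool" where
  "isometric A B \<longleftrightarrow> dim_row A = dim_row B \<and>
     (\<exists>P \<in> carrier_mat (dim_row A) (dim_row A). invertible_mat P \<and> B = transpose_mat P * A * P)"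

definition orth_sum :: "'a::field mat \<Rightarrow> 'a mat \<Rightarrow> 'a mat" where
  "orth_sum A B = four_block_mat A (0\<^sub>m (dim_row A) (dim_col B)) (0\<^sub>m (dim_row B) (dim_col A)) B"

definition tensor_form :: "'a::field mat \<Rightarrow> 'a mat \<Rightarrow> 'a mat" where
  "tensor_form A B = mat (dim_row A * dim_row B) (dim_col A * dim_col B)
     (\<lambda>(i, j). A $$ (i div dim_row B, j div dim_col B) * B $$ (i mod dim_row B, j mod dim_col B))"

text \<open>
  A form is metabolic if it has a Lagrangian, i.e. a subspace \<open>N\<close> equal to its own orthogonal
  complement; the equation \<open>N = N\<^sup>\<bottom>\<close> already forces \<open>N\<close> to be a linear subspace.  In characteristic
  2 this is weaker than being hyperbolic.
\<close>

definition metabolic :: "'a::field mat \<Rightarrow> bool" where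
  "metabolic A \<longleftrightarrow> A \<in> sym_forms \<and>
     (\<exists>N. N = {v \<in> carrier_vec (dim_row A). \<forall>w \<in> N. v \<bullet> (A *\<^sub>v w) = 0})"

definition witt_equiv :: "'a::field mat \<Rightarrow> 'a mat \<Rightarrow> bool" where
  "witt_equiv A B \<longleftrightarrow>
     (\<exists>M M'. metabolic M \<and> metabolic M' \<and> isometric (orth_sum A M) (orth_sum B M'))"

definition witt_class :: "'a::field mat \<Rightarrow> 'a mat set" where
  "witt_class A = {B \<in> sym_forms. witt_equiv A B}"

text \<open>
  The zero of the Witt ring is the class of the form of rank 0, whose members are the metabolic
  forms.
\<close>

definition witt_ring :: "'a::field mat set ring" where
  "witt_ring =
     \<lparr>carrier = witt_class ` sym_forms,
      monoid.mult = (\<lambda>U V. \<Union>A\<in>U. \<Union>B\<in>V. witt_class (tensor_form A B)),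
      one = witt_class (1\<^sub>m 1),
      ring.zero = witt_class (0\<^sub>m 0 0),
      add = (\<lambda>U V. \<Union>A\<in>U. \<Union>B\<in>V. witt_class (orth_sum A B))\<rparr>"

definition rank_one :: "'a::field \<Rightarrow> 'a mat set" where
  "rank_one a = witt_class (mat 1 1 (\<lambda>_. a))"

lemma one_witt_ring: "\<one>\<^bsub>witt_ring\<^esub> = rank_one 1"
proof -
  have "(1\<^sub>m 1 :: 'a mat) = mat 1 1 (\<lambda>_. 1)"
    by (rule eq_matI) auto
  then show ?thesis
    by (simp add: witt_ring_def rank_one_def)
qed

text \<open>
  For \<open>G Mod N\<close> the type of the elements grows with each quotient, so a sequence of successive
  quotients is not a function on \<open>nat\<close>.  The elements of the Witt ring are pairwise disjoint
  nonempty sets, and for such a group a coset of \<open>N\<close> is determined by its union.  The quotient below is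
  \<open>G Mod N\<close> with every coset replaced by its union (lemma \<open>flat_quot_iso\<close>); its elements are
  again pairwise disjoint and nonempty (lemma \<open>flat_quot_disjoint\<close>), so it can be iterated.
\<close>

definition flat_quot :: "'b set monoid \<Rightarrow> 'b set set \<Rightarrow> 'b set monoid" where
  "flat_quot G N = image_group Union (G Mod N)"

definition flat_proj :: "'b set monoid \<Rightarrow> 'b set set \<Rightarrow> 'b set \<Rightarrow> 'b set" where
  "flat_proj G N x = \<Union> (N #>\<^bsub>G\<^esub> x)"

lemma Union_inj_on_rcosets:
  assumes "N \<lhd> G" and "disjoint (carrier G)" and "{} \<notin> carrier G"
  shows "inj_on Union (carrier (G Mod N))"
proof (rule inj_onI)
  interpret normal N G by fact
  have sub: "K \<subseteq> L"
    if K: "K \<in> carrier (G Mod N)" and L: "L \<in> carrier (G Mod N)" and eq: "\<Union>K = \<Union>L" for K L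
  proof
    fix x assume x: "x \<in> K"
    have KL: "K \<subseteq> carrier G" "L \<subseteq> carrier G"
      using K L Union_upper[of _ "rcosets\<^bsub>G\<^esub> N"] rcosets_part_G[OF is_subgroup]
      by (simp_all add: FactGroup_def)
    have "x \<noteq> {}" using KL(1) x assms(3) by blast
    then obtain e where e: "e \<in> x" by blast
    with x eq obtain y where y: "y \<in> L" "e \<in> y" by blast
    have "x \<in> carrier G" "y \<in> carrier G" using KL x y(1) by blast+
    then have "x = y" using disjointD[OF assms(2), of x y] e y(2) by blast
    with y show "x \<in> L" by simp
  qed
  show "K = L" if "K \<in> carrier (G Mod N)" "L \<in> carrier (G Mod N)" "\<Union>K = \<Union>L" for K L
    using sub[OF that] sub[OF that(2,1) that(3)[symmetric]] by blast
qed

lemma flat_quot_iso: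
  assumes "N \<lhd> G" and "disjoint (carrier G)" and "{} \<notin> carrier G"
  shows "Union \<in> iso (G Mod N) (flat_quot G N)"
  unfolding flat_quot_def
  by (rule inj_imp_image_group_iso[OF Union_inj_on_rcosets[OF assms]])

lemma flat_quot_disjoint:
  assumes "N \<lhd> G" and "disjoint (carrier G)" and "{} \<notin> carrier G"
  shows "disjoint (carrier (flat_quot G N))" and "{} \<notin> carrier (flat_quot G N)"
proof -
  interpret normal N G by fact
  have car: "carrier (flat_quot G N) = Union ` (rcosets\<^bsub>G\<^esub> N)"
    by (simp add: flat_quot_def image_group_def FactGroup_def)
  show "disjoint (carrier (flat_quot G N))"
  proof (rule disjointI)
    fix U V assume "U \<in> carrier (flat_quot G N)" "V \<in> carrier (flat_quot G N)" and ne: "U \<noteq> V"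
    then have "U \<in> Union ` (rcosets\<^bsub>G\<^esub> N)" "V \<in> Union ` (rcosets\<^bsub>G\<^esub> N)"
      by (simp_all only: car)
    then obtain K L where K: "K \<in> rcosets\<^bsub>G\<^esub> N" "U = \<Union>K" and L: "L \<in> rcosets\<^bsub>G\<^esub> N" "V = \<Union>L"
      by (elim imageE)
    have "K \<inter> L = {}"
      using pairwiseD[OF rcos_disjoint[OF is_subgroup] K(1) L(1)] K(2) L(2) ne
      by (auto simp only: disjnt_def)
    moreover have "K \<subseteq> carrier G" "L \<subseteq> carrier G"
      using K(1) L(1) Union_upper[of _ "rcosets\<^bsub>G\<^esub> N"] rcosets_part_G[OF is_subgroup]
      by simp_all
    ultimately have "x \<inter> y = {}" if "x \<in> K" "y \<in> L" for x y
      using that by (intro disjointD[OF assms(2)]) auto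
    then have "\<Union>K \<inter> \<Union>L = {}"
      by blast
    then show "U \<inter> V = {}"
      using K(2) L(2) by simp
  qed
  show "{} \<notin> carrier (flat_quot G N)"
  proof
    assume "{} \<in> carrier (flat_quot G N)"
    then obtain x where x: "x \<in> carrier G" "\<Union> (N #>\<^bsub>G\<^esub> x) = {}"
      unfolding car RCOSETS_def by auto
    then have "x \<in> N #>\<^bsub>G\<^esub> x"
      using rcos_self is_subgroup by blast
    with x(2) have "x = {}" by simp
    with x(1) assms(3) show False by simp
  qed
qed

text \<open>
  \<open>iter_proj Q s m\<close> is the composite of the projections \<open>Q 0 \<rightarrow> Q 1 \<rightarrow> \<dots> \<rightarrow> Q m\<close> when each \<open>Q (i + 1)\<close> is the
  quotient of \<open>Q i\<close> by the subgroup generated by \<open>s i\<close>.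
\<close>

primrec iter_proj ::
    "(nat \<Rightarrow> 'b set monoid) \<Rightarrow> (nat \<Rightarrow> 'b set) \<Rightarrow> nat \<Rightarrow> 'b set \<Rightarrow> 'b set" where
  "iter_proj Q s 0 x = x"
| "iter_proj Q s (Suc m) x = flat_proj (Q m) (generate (Q m) {s m}) (iter_proj Q s m x)"

end

theory Submission
  imports Defs "HOL-Library.Function_Algebras" "Jordan_Normal_Form.Determinant"
begin

text \<open>
  For units \<open>a1, \<dots>, an\<close> let \<open>\<lambda>(a)\<close> be the polynomial \<open>\<Prod> (1 + \<langle>ai\<rangle> t)\<close> over the Witt ring.  Its
  coefficients are the elementary symmetric functions of the \<open>\<langle>ai\<rangle>\<close>, and the coefficient of \<open>t\<^sup>k\<close> is
  the sum over subsets with \<open>k\<close> elements, before it is projected.  It is not determined by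
  \<open>d = \<Sum> \<langle>ai\<rangle>\<close>, because a hyperbolic plane \<open>\<langle>c\<rangle> + \<langle>-c\<rangle>\<close> is zero in the Witt ring but contributes
  the factor \<open>(1 + \<langle>c\<rangle> t) (1 + \<langle>-c\<rangle> t) = 1 - t\<^sup>2\<close>.  The point is that nothing else can happen: if
  \<open>\<Sum> \<langle>ai\<rangle> = \<Sum> \<langle>bj\<rangle>\<close>, then \<open>\<lambda>(a) (1 - t\<^sup>2)\<^sup>r = \<lambda>(b) (1 - t\<^sup>2)\<^sup>s\<close> for some \<open>r\<close> and \<open>s\<close>
  (lemma \<open>esym_eq_up_to_hyp\<close>).  Multiplying by \<open>1 - t\<^sup>2\<close> changes the coefficient of degree \<open>2 m + 2\<close>
  by the one of degree \<open>2 m\<close>.  By induction the latter is sent to the \<open>m\<close>-th element of the sequence,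
  which the next quotient kills (lemma \<open>quot_proj_esym\<close>), so that the element of index \<open>m + 1\<close> is well
  defined.

  By passing to differences it is enough to treat \<open>\<Sum> \<langle>ai\<rangle> = 0\<close> (lemma \<open>esym_eq_hyp_if_zero\<close>).  The
  diagonal form then becomes metabolic after adding a metabolic form, and so it has an isotropic
  vector (lemma \<open>isotropic_if_stably_metabolic\<close>).  After changing the \<open>ai\<close> by squares this means that
  some of them have sum zero in the field.  Replacing a pair \<open>a, b\<close> by \<open>a + b, (a + b) a b\<close> does not
  change \<open>\<lambda>\<close>, and merging entries in this way makes a pair \<open>c, -c\<close> appear (lemma
  \<open>esym_eq_hyperbolic_if_sum_zero\<close>).  This pair splits off as a factor \<open>1 - t\<^sup>2\<close>, and induction on
  the length finishes the argument.

  Uniqueness, and the choice of the elements in the construction, rest on the fact that every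
  element of the Witt ring is a sum of rank one classes (lemma \<open>W_induct\<close>).  Products in the Witt
  ring occur only with rank one factors, where they are given by scaling a form by a unit.
\<close>

section \<open>Isometries and orthogonal sums\<close>

lemma sym_forms_carrier:
  assumes "A \<in> sym_forms"
  obtains n where "A \<in> carrier_mat n n"
  using assms unfolding sym_forms_def invertible_mat_def square_mat.simps carrier_mat_def by simp

lemma invertible_matI:
  assumes "A \<in> carrier_mat n n" "B \<in> carrier_mat n n" "A * B = 1\<^sub>m n" "B * A = 1\<^sub>m n"
  shows "invertible_mat A"
  using assms by (auto simp: invertible_mat_def inverts_mat_def square_mat.simps)

lemma invertible_matE:
  assumes "invertible_mat A" "A \<in> carrier_mat n n"
  obtains B where "B \<in> carrier_mat n n" "A * B = 1\<^sub>m n" "B * A = 1\<^sub>m n"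
proof -
  obtain B where B: "A * B = 1\<^sub>m (dim_row A)" "B * A = 1\<^sub>m (dim_row B)"
    using assms(1) by (auto simp: invertible_mat_def inverts_mat_def)
  have "dim_col B = n" using arg_cong[OF B(1), of dim_col] assms(2) by simp
  moreover have "dim_row B = n" using arg_cong[OF B(2), of dim_col] assms(2) by simp
  ultimately show thesis using that[of B] B assms(2) by auto
qed

lemma sym_formsE:
  assumes "A \<in> sym_forms"
  obtains n A' where "A \<in> carrier_mat n n" "transpose_mat A = A"
    "A' \<in> carrier_mat n n" "A * A' = 1\<^sub>m n" "A' * A = 1\<^sub>m n"
proof -
  obtain n where n: "A \<in> carrier_mat n n" using sym_forms_carrier[OF assms] .
  have A: "transpose_mat A = A" "invertible_mat A" using assms by (simp_all add: sym_forms_def)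
  show thesis using invertible_matE[OF A(2) n] that[OF n A(1)] .
qed

lemma isometricI:
  assumes "A \<in> carrier_mat n n" "P \<in> carrier_mat n n" "Q \<in> carrier_mat n n"
    "P * Q = 1\<^sub>m n" "Q * P = 1\<^sub>m n" "B = transpose_mat P * A * P"
  shows "isometric A B"
proof -
  have "dim_row A = n" "dim_row B = n" using assms(1,2,6) by simp_all
  then show ?thesis
    unfolding isometric_def using assms(2,6) invertible_matI[OF assms(2-5)]
    by (intro conjI bexI[of _ P]) simp_all
qed

lemma isometricE:
  assumes "isometric A B" "A \<in> carrier_mat n n"
  obtains P Q where "P \<in> carrier_mat n n" "Q \<in> carrier_mat n n"
    "P * Q = 1\<^sub>m n" "Q * P = 1\<^sub>m n" "B = transpose_mat P * A * P"
proof -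
  have "dim_row A = n" using assms(2) by simp
  then obtain P where P: "P \<in> carrier_mat n n" "invertible_mat P" "B = transpose_mat P * A * P"
    using assms unfolding isometric_def by blast
  obtain Q where Q: "Q \<in> carrier_mat n n" "P * Q = 1\<^sub>m n" "Q * P = 1\<^sub>m n"
    using invertible_matE[OF P(2,1)] by blast
  show thesis by (rule that[OF P(1) Q P(3)])
qed

lemma isometric_refl: "A \<in> carrier_mat n n \<Longrightarrow> isometric A A"
  by (rule isometricI[of _ n "1\<^sub>m n" "1\<^sub>m n"]) auto

lemma isometric_sym:
  assumes "isometric A B" "A \<in> carrier_mat n n"
  shows "isometric B A"
proof -
  obtain P Q where P: "P \<in> carrier_mat n n" "Q \<in> carrier_mat n n"
    "P * Q = 1\<^sub>m n" "Q * P = 1\<^sub>m n" "B = transpose_mat P * A * P"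
    using isometricE[OF assms] .
  have QP: "transpose_mat Q * transpose_mat P = 1\<^sub>m n"
    using transpose_mult[OF P(1,2)] P(3) by simp
  have "transpose_mat Q * B * Q = transpose_mat Q * (transpose_mat P * A * P) * Q"
    using P by simp
  also have "\<dots> = (transpose_mat Q * transpose_mat P) * A * (P * Q)"
    using P(1,2) assms(2) by (simp add: assoc_mult_mat[of _ n n _ n _ n])
  also have "\<dots> = A" using assms(2) P(3) QP by simp
  finally show ?thesis
    using P assms by (intro isometricI[of _ n Q P]) auto
qed

lemma isometric_trans:
  assumes "isometric A B" "isometric B C" "A \<in> carrier_mat n n"
  shows "isometric A C"
proof -
  obtain P Q where P: "P \<in> carrier_mat n n" "Q \<in> carrier_mat n n"
    "P * Q = 1\<^sub>m n" "Q * P = 1\<^sub>m n" "B = transpose_mat P * A * P"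
    using isometricE[OF assms(1,3)] .
  have B: "B \<in> carrier_mat n n" using P assms by auto
  obtain R S where R: "R \<in> carrier_mat n n" "S \<in> carrier_mat n n"
    "R * S = 1\<^sub>m n" "S * R = 1\<^sub>m n" "C = transpose_mat R * B * R"
    using isometricE[OF assms(2) B] .
  note a = assoc_mult_mat[of _ n n _ n _ n]
  have "P * R * (S * Q) = P * (R * S) * Q" using P(1,2) R(1,2) by (simp add: a)
  then have 1: "P * R * (S * Q) = 1\<^sub>m n" using P(1,3) R(3) by simp
  have "S * Q * (P * R) = S * (Q * P) * R" using P(1,2) R(1,2) by (simp add: a)
  then have 2: "S * Q * (P * R) = 1\<^sub>m n" using P(4) R(2,4) by simp
  have "C = transpose_mat (P * R) * A * (P * R)"
    using P(1,2,5) R(1,2,5) assms(3) by (simp add: a transpose_mult[of _ n n _ n])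
  then show ?thesis
    using P(1,2) R(1,2) assms(3) 1 2 by (intro isometricI[of _ n "P * R" "S * Q"]) auto
qed

lemma isometric_dim: "isometric A B \<Longrightarrow> A \<in> carrier_mat n n \<Longrightarrow> B \<in> carrier_mat n n"
  by (auto elim!: isometricE)

lemma isometric_sym_forms:
  assumes "isometric A B" "A \<in> sym_forms"
  shows "B \<in> sym_forms"
proof -
  obtain n A' where A: "A \<in> carrier_mat n n" "transpose_mat A = A"
    and A': "A' \<in> carrier_mat n n" "A * A' = 1\<^sub>m n" "A' * A = 1\<^sub>m n"
    using assms(2) by (rule sym_formsE)
  obtain P Q where P: "P \<in> carrier_mat n n" "Q \<in> carrier_mat n n"
    "P * Q = 1\<^sub>m n" "Q * P = 1\<^sub>m n" "B = transpose_mat P * A * P"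
    using isometricE[OF assms(1) A(1)] .
  note a = assoc_mult_mat[of _ n n _ n _ n]
  have tP: "transpose_mat Q * transpose_mat P = 1\<^sub>m n"
    using transpose_mult[OF P(1,2)] P(3) by simp
  have tQ: "transpose_mat P * transpose_mat Q = 1\<^sub>m n"
    using transpose_mult[OF P(2,1)] P(4) by simp
  have "transpose_mat B = B"
    using P(1,2,5) A(1,2) by (simp add: a transpose_mult[of _ n n _ n])
  moreover have "invertible_mat B"
  proof (rule invertible_matI[of _ n "Q * A' * transpose_mat Q"])
    have "B * (Q * A' * transpose_mat Q) = transpose_mat P * (A * ((P * Q) * A')) * transpose_mat Q"
      using P(1,2,5) A A' by (simp add: a)
    then show "B * (Q * A' * transpose_mat Q) = 1\<^sub>m n"
      using P A A' tP tQ by simp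
    have "Q * A' * transpose_mat Q * B = Q * (A' * ((transpose_mat Q * transpose_mat P) * A)) * P"
      using P(1,2,5) A A' by (simp add: a)
    then show "Q * A' * transpose_mat Q * B = 1\<^sub>m n"
      using P A A' tP tQ by simp
  qed (use P A A' in auto)
  ultimately show ?thesis by (simp add: sym_forms_def)
qed

lemma orth_sum_carrier [simp, intro]:
  "A \<in> carrier_mat n n' \<Longrightarrow> B \<in> carrier_mat m m' \<Longrightarrow> orth_sum A B \<in> carrier_mat (n + m) (n' + m')"
  by (simp add: orth_sum_def)

lemma orth_sum_mult:
  assumes "A \<in> carrier_mat n n" "B \<in> carrier_mat m m" "C \<in> carrier_mat n n" "D \<in> carrier_mat m m"
  shows "orth_sum A B * orth_sum C D = orth_sum (A * C) (B * D)"
  using assms mult_four_block_mat[of A n n "0\<^sub>m n m" m "0\<^sub>m m n" m B C n "0\<^sub>m n m" m "0\<^sub>m m n" D]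
  by (simp add: orth_sum_def)

lemma orth_sum_transpose:
  assumes "A \<in> carrier_mat n n" "B \<in> carrier_mat m m"
  shows "transpose_mat (orth_sum A B) = orth_sum (transpose_mat A) (transpose_mat B)"
  using assms transpose_four_block_mat[of A n n "0\<^sub>m n m" m "0\<^sub>m m n" m B]
  by (simp add: orth_sum_def)

lemma orth_sum_one: "orth_sum (1\<^sub>m n) (1\<^sub>m m) = 1\<^sub>m (n + m)"
  by (simp add: orth_sum_def)

lemma orth_sum_assoc: "orth_sum (orth_sum A B) C = orth_sum A (orth_sum B C)"
  using assoc_four_block_mat[of A B C] by (simp add: orth_sum_def)

lemma orth_sum_smult:
  assumes "A \<in> carrier_mat n n" "B \<in> carrier_mat m m"
  shows "c \<cdot>\<^sub>m orth_sum A B = orth_sum (c \<cdot>\<^sub>m A) (c \<cdot>\<^sub>m B)"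
  using assms smult_four_block_mat[of A n n "0\<^sub>m n m" m "0\<^sub>m m n" m B c]
  by (simp add: orth_sum_def)

lemma orth_sum_zero_left [simp]: "orth_sum (0\<^sub>m 0 0) A = A"
  by (rule eq_matI) (auto simp: orth_sum_def)

lemma orth_sum_zero_right [simp]: "orth_sum A (0\<^sub>m 0 0) = A"
  by (rule eq_matI) (auto simp: orth_sum_def)

lemma isometric_orth_sum:
  assumes "isometric A A'" "isometric B B'" "A \<in> carrier_mat n n" "B \<in> carrier_mat m m"
  shows "isometric (orth_sum A B) (orth_sum A' B')"
proof -
  obtain P Q where P: "P \<in> carrier_mat n n" "Q \<in> carrier_mat n n"
    "P * Q = 1\<^sub>m n" "Q * P = 1\<^sub>m n" "A' = transpose_mat P * A * P"
    using isometricE[OF assms(1,3)] .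
  obtain R S where R: "R \<in> carrier_mat m m" "S \<in> carrier_mat m m"
    "R * S = 1\<^sub>m m" "S * R = 1\<^sub>m m" "B' = transpose_mat R * B * R"
    using isometricE[OF assms(2,4)] .
  show ?thesis
  proof (rule isometricI)
    show "orth_sum P R * orth_sum Q S = 1\<^sub>m (n + m)" "orth_sum Q S * orth_sum P R = 1\<^sub>m (n + m)"
      using P R by (simp_all add: orth_sum_mult[of _ n _ m] orth_sum_one)
    show "orth_sum A' B' = transpose_mat (orth_sum P R) * orth_sum A B * orth_sum P R"
      using P R assms(3,4) by (simp add: orth_sum_mult[of _ n _ m] orth_sum_transpose[of _ n _ m])
  qed (use P R assms in auto)
qed

lemma isometric_orth_sum_commute:
  assumes "A \<in> carrier_mat n n" "B \<in> carrier_mat m m"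
  shows "isometric (orth_sum A B) (orth_sum B A)"
proof -
  define P :: "'a mat" where
    "P = mat (n + m) (n + m) (\<lambda>(i, j). if j < m \<and> i = n + j \<or> j \<ge> m \<and> j = m + i then 1 else 0)"
  have P: "P = four_block_mat (0\<^sub>m n m) (1\<^sub>m n) (1\<^sub>m m) (0\<^sub>m m n)"
    by (rule eq_matI) (auto simp: P_def)
  have Pt: "transpose_mat P = four_block_mat (0\<^sub>m m n) (1\<^sub>m m) (1\<^sub>m n) (0\<^sub>m n m)"
    unfolding P by (subst transpose_four_block_mat[of _ n m _ n _ m]) auto
  have Pc: "P \<in> carrier_mat (n + m) (n + m)" by (simp add: P_def)
  have eq: "transpose_mat P * orth_sum A B = four_block_mat (0\<^sub>m m n) B A (0\<^sub>m n m)"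
    unfolding Pt orth_sum_def using assms
    by (subst mult_four_block_mat[of _ m n _ m _ n _ _ n _ m]) auto
  have eq2: "four_block_mat (0\<^sub>m m n) B A (0\<^sub>m n m) * P = orth_sum B A"
    unfolding P orth_sum_def using assms
    by (subst mult_four_block_mat[of _ m n _ m _ n _ _ m _ n]) auto
  have "P * transpose_mat P = 1\<^sub>m (n + m)"
    unfolding Pt unfolding P
    by (subst mult_four_block_mat[of _ n m _ n _ m _ _ n _ m]) auto
  moreover have "transpose_mat P * P = 1\<^sub>m (m + n)"
    unfolding Pt unfolding P
    by (subst mult_four_block_mat[of _ m n _ m _ n _ _ m _ n]) auto
  ultimately show ?thesis
    using assms Pc eq eq2
    by (intro isometricI[of _ "n + m" P "transpose_mat P"]) (auto simp only: add.commute[of m n] orth_sum_carrier transpose_carrier_mat)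
qed

lemma orth_sum_sym_forms:
  assumes "A \<in> sym_forms" "B \<in> sym_forms"
  shows "orth_sum A B \<in> sym_forms"
proof -
  obtain n A' where A: "A \<in> carrier_mat n n" "transpose_mat A = A"
    and A': "A' \<in> carrier_mat n n" "A * A' = 1\<^sub>m n" "A' * A = 1\<^sub>m n"
    using assms(1) by (rule sym_formsE)
  obtain m B' where B: "B \<in> carrier_mat m m" "transpose_mat B = B"
    and B': "B' \<in> carrier_mat m m" "B * B' = 1\<^sub>m m" "B' * B = 1\<^sub>m m"
    using assms(2) by (rule sym_formsE)
  have "invertible_mat (orth_sum A B)"
    using A B A' B' by (intro invertible_matI[of _ "n + m" "orth_sum A' B'"])
      (auto simp: orth_sum_mult[of _ n _ m] orth_sum_one)
  then show ?thesis
    using A B by (simp add: sym_forms_def orth_sum_transpose[of _ n _ m])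
qed

lemma transpose_smult: "transpose_mat (c \<cdot>\<^sub>m A) = c \<cdot>\<^sub>m transpose_mat A"
  by (rule eq_matI) auto

lemma smult_smult: "a \<cdot>\<^sub>m (b \<cdot>\<^sub>m A) = (a * b) \<cdot>\<^sub>m (A :: 'a::field mat)"
  by (rule eq_matI) (auto simp: mult.assoc)

lemma one_smult_mat [simp]: "(1 :: 'a::field) \<cdot>\<^sub>m A = A"
  by (rule eq_matI) auto

lemma smult_mult_smult:
  fixes A B :: "'a::field mat"
  assumes "A \<in> carrier_mat n n" "B \<in> carrier_mat n n"
  shows "(a \<cdot>\<^sub>m A) * (b \<cdot>\<^sub>m B) = (a * b) \<cdot>\<^sub>m (A * B)"
proof -
  have "(a \<cdot>\<^sub>m A) * (b \<cdot>\<^sub>m B) = a \<cdot>\<^sub>m (b \<cdot>\<^sub>m (A * B))"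
    using mult_smult_assoc_mat[OF assms(1) smult_carrier_mat[OF assms(2)]]
      mult_smult_distrib[OF assms] by metis
  then show ?thesis by (simp only: smult_smult)
qed

lemma smult_sym_forms:
  assumes "A \<in> sym_forms" "c \<noteq> 0"
  shows "c \<cdot>\<^sub>m A \<in> sym_forms"
proof -
  obtain n A' where A: "A \<in> carrier_mat n n" "transpose_mat A = A"
    and A': "A' \<in> carrier_mat n n" "A * A' = 1\<^sub>m n" "A' * A = 1\<^sub>m n"
    using assms(1) by (rule sym_formsE)
  have "(c \<cdot>\<^sub>m A) * (inverse c \<cdot>\<^sub>m A') = 1\<^sub>m n"
    using smult_mult_smult[OF A(1) A'(1), of c "inverse c"] A'(2) assms(2) by simp
  moreover have "(inverse c \<cdot>\<^sub>m A') * (c \<cdot>\<^sub>m A) = 1\<^sub>m n"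
    using smult_mult_smult[OF A'(1) A(1), of "inverse c" c] A'(3) assms(2) by simp
  ultimately have "invertible_mat (c \<cdot>\<^sub>m A)"
    using A A' by (intro invertible_matI[of _ n "inverse c \<cdot>\<^sub>m A'"]) auto
  moreover have "transpose_mat (c \<cdot>\<^sub>m A) = c \<cdot>\<^sub>m A"
    using A(2) by (simp add: transpose_smult)
  ultimately show ?thesis by (simp add: sym_forms_def)
qed

lemma isometric_smult:
  assumes "isometric A B" "A \<in> carrier_mat n n"
  shows "isometric (c \<cdot>\<^sub>m A) (c \<cdot>\<^sub>m B)"
proof -
  obtain P Q where P: "P \<in> carrier_mat n n" "Q \<in> carrier_mat n n"
    "P * Q = 1\<^sub>m n" "Q * P = 1\<^sub>m n" "B = transpose_mat P * A * P"
    using isometricE[OF assms] .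
  show ?thesis
  proof (rule isometricI[of _ n P Q])
    show "c \<cdot>\<^sub>m B = transpose_mat P * (c \<cdot>\<^sub>m A) * P"
      using P assms(2)
      by (simp add: mult_smult_distrib[of _ n n _ n] mult_smult_assoc_mat[of _ n n _ n])
  qed (use P assms in auto)
qed

lemma isometric_smult_square:
  assumes "A \<in> carrier_mat n n" "c \<noteq> 0"
  shows "isometric A ((c * c) \<cdot>\<^sub>m A)"
proof (rule isometricI[of _ n "c \<cdot>\<^sub>m 1\<^sub>m n" "inverse c \<cdot>\<^sub>m 1\<^sub>m n"])
  have "transpose_mat (c \<cdot>\<^sub>m 1\<^sub>m n) * A = c \<cdot>\<^sub>m A"
    using mult_smult_assoc_mat[of "1\<^sub>m n" n n A n c] assms(1) by (simp add: transpose_smult)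
  then show "(c * c) \<cdot>\<^sub>m A = transpose_mat (c \<cdot>\<^sub>m 1\<^sub>m n) * A * (c \<cdot>\<^sub>m 1\<^sub>m n)"
    using smult_mult_smult[OF assms(1), of "1\<^sub>m n" c c] assms(1) by simp
  show "c \<cdot>\<^sub>m 1\<^sub>m n * (inverse c \<cdot>\<^sub>m 1\<^sub>m n) = 1\<^sub>m n"
    using smult_mult_smult[of "1\<^sub>m n" n "1\<^sub>m n" c "inverse c"] assms(2) by simp
  show "inverse c \<cdot>\<^sub>m 1\<^sub>m n * (c \<cdot>\<^sub>m 1\<^sub>m n) = 1\<^sub>m n"
    using smult_mult_smult[of "1\<^sub>m n" n "1\<^sub>m n" "inverse c" c] assms(2) by simp
qed (use assms in auto)

section \<open>Metabolic forms\<close>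

abbreviation bil :: "'a::field mat \<Rightarrow> 'a vec \<Rightarrow> 'a vec \<Rightarrow> 'a" where
  "bil A v w \<equiv> v \<bullet> (A *\<^sub>v w)"

lemma bil_commute:
  fixes A :: "'a::field mat"
  assumes "A \<in> carrier_mat n n" "transpose_mat A = A" "v \<in> carrier_vec n" "w \<in> carrier_vec n"
  shows "bil A v w = bil A w v"
proof -
  have "bil A v w = (A *\<^sub>v v) \<bullet> w"
    using transpose_vec_mult_scalar[OF assms(1,4,3)] assms(2) by simp
  also have "\<dots> = bil A w v"
    by (rule comm_scalar_prod[of _ n]) (use assms in auto)
  finally show ?thesis .
qed

lemma bil_add_left:
  fixes A :: "'a::field mat"
  assumes "A \<in> carrier_mat n n" "v \<in> carrier_vec n" "v' \<in> carrier_vec n" "w \<in> carrier_vec n"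
  shows "bil A (v + v') w = bil A v w + bil A v' w"
  using assms by (intro add_scalar_prod_distrib[of _ n]) auto

lemma bil_smult_left:
  fixes A :: "'a::field mat"
  assumes "A \<in> carrier_mat n n" "v \<in> carrier_vec n" "w \<in> carrier_vec n"
  shows "bil A (c \<cdot>\<^sub>v v) w = c * bil A v w"
  using assms by (intro smult_scalar_prod_distrib[of _ n]) auto

lemma bil_smult_mat:
  fixes A :: "'a::field mat"
  assumes "A \<in> carrier_mat n n" "v \<in> carrier_vec n" "w \<in> carrier_vec n"
  shows "bil (c \<cdot>\<^sub>m A) v w = c * bil A v w"
proof -
  have "(c \<cdot>\<^sub>m A) *\<^sub>v w = c \<cdot>\<^sub>v (A *\<^sub>v w)"
    using assms by (intro eq_vecI) auto
  then show ?thesis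
    using scalar_prod_smult_distrib[of v n "A *\<^sub>v w" c] assms by simp
qed

lemma bil_orth_sum:
  fixes A :: "'a::field mat"
  assumes "A \<in> carrier_mat n n" "B \<in> carrier_mat m m"
    "v \<in> carrier_vec n" "w \<in> carrier_vec n" "v' \<in> carrier_vec m" "w' \<in> carrier_vec m"
  shows "bil (orth_sum A B) (v @\<^sub>v v') (w @\<^sub>v w') = bil A v w + bil B v' w'"
proof -
  have "orth_sum A B *\<^sub>v (w @\<^sub>v w') = A *\<^sub>v w @\<^sub>v B *\<^sub>v w'"
    using mult_mat_vec_split[OF assms(1,2,4,6)] assms(1,2) by (simp add: orth_sum_def)
  then show ?thesis
    using scalar_prod_append[of v n v' m "A *\<^sub>v w" "B *\<^sub>v w'"] assms by simp
qed

lemma bil_congruence: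
  fixes A :: "'a::field mat"
  assumes "A \<in> carrier_mat n n" "P \<in> carrier_mat n n" "v \<in> carrier_vec n" "w \<in> carrier_vec n"
  shows "bil (transpose_mat P * A * P) v w = bil A (P *\<^sub>v v) (P *\<^sub>v w)"
proof -
  have "(transpose_mat P * A * P) *\<^sub>v w = transpose_mat P *\<^sub>v (A *\<^sub>v (P *\<^sub>v w))"
    using assms by (simp add: assoc_mult_mat_vec[of _ n n _ n])
  then have "bil (transpose_mat P * A * P) v w = (transpose_mat P *\<^sub>v (A *\<^sub>v (P *\<^sub>v w))) \<bullet> v"
    using comm_scalar_prod[of v n "transpose_mat P *\<^sub>v (A *\<^sub>v (P *\<^sub>v w))"] assms by simp
  also have "\<dots> = (A *\<^sub>v (P *\<^sub>v w)) \<bullet> (P *\<^sub>v v)"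
    using transpose_vec_mult_scalar[of P n n v "A *\<^sub>v (P *\<^sub>v w)"] assms by simp
  also have "\<dots> = bil A (P *\<^sub>v v) (P *\<^sub>v w)"
    using comm_scalar_prod[of "P *\<^sub>v v" n "A *\<^sub>v (P *\<^sub>v w)"] assms by simp
  finally show ?thesis .
qed

lemma nondegenerate:
  fixes A :: "'a::field mat"
  assumes "A \<in> carrier_mat n n" "A' \<in> carrier_mat n n" "A * A' = 1\<^sub>m n" "v \<in> carrier_vec n"
    and "\<And>w. w \<in> carrier_vec n \<Longrightarrow> bil A v w = 0"
  shows "v = 0\<^sub>v n"
proof (rule eq_vecI)
  fix i assume i: "i < dim_vec (0\<^sub>v n :: 'a vec)"
  have "A *\<^sub>v (A' *\<^sub>v unit_vec n i) = unit_vec n i"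
    using assoc_mult_mat_vec[OF assms(1,2), of "unit_vec n i"] assms(3) by simp
  then have "v \<bullet> unit_vec n i = 0"
    using assms(5)[of "A' *\<^sub>v unit_vec n i"] assms(2) by simp
  then show "v $ i = 0\<^sub>v n $ i" using i assms(4) by simp
qed (use assms in simp)

lemma metabolicI:
  assumes "A \<in> sym_forms" "A \<in> carrier_mat n n" "N \<subseteq> carrier_vec n"
    and "\<And>v w. v \<in> N \<Longrightarrow> w \<in> N \<Longrightarrow> bil A v w = 0"
    and "\<And>v. v \<in> carrier_vec n \<Longrightarrow> (\<And>w. w \<in> N \<Longrightarrow> bil A v w = 0) \<Longrightarrow> v \<in> N"
  shows "metabolic A"
proof -
  have "dim_row A = n" using assms(2) by simp
  then show ?thesis
    using assms unfolding metabolic_def by (intro conjI exI[of _ N]) auto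
qed

lemma metabolicE:
  assumes "metabolic A" "A \<in> carrier_mat n n"
  obtains N where "N \<subseteq> carrier_vec n" "\<And>v w. v \<in> N \<Longrightarrow> w \<in> N \<Longrightarrow> bil A v w = 0"
    "\<And>v. v \<in> carrier_vec n \<Longrightarrow> (\<And>w. w \<in> N \<Longrightarrow> bil A v w = 0) \<Longrightarrow> v \<in> N"
proof -
  have "dim_row A = n" using assms(2) by simp
  then obtain N where "N = {v \<in> carrier_vec n. \<forall>w \<in> N. bil A v w = 0}"
    using assms(1) unfolding metabolic_def by blast
  then show thesis by (intro that[of N]) blast+
qed

lemma metabolic_sym_forms: "metabolic A \<Longrightarrow> A \<in> sym_forms"
  by (simp add: metabolic_def)

lemma metabolic_isometric:
  assumes "metabolic A" "isometric A B"
  shows "metabolic B"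
proof -
  obtain n where A: "A \<in> carrier_mat n n"
    using sym_forms_carrier[OF metabolic_sym_forms[OF assms(1)]] .
  obtain P Q where P: "P \<in> carrier_mat n n" "Q \<in> carrier_mat n n"
    "P * Q = 1\<^sub>m n" "Q * P = 1\<^sub>m n" "B = transpose_mat P * A * P"
    using isometricE[OF assms(2) A] .
  obtain N where N: "N \<subseteq> carrier_vec n" "\<And>v w. v \<in> N \<Longrightarrow> w \<in> N \<Longrightarrow> bil A v w = 0"
    "\<And>v. v \<in> carrier_vec n \<Longrightarrow> (\<And>w. w \<in> N \<Longrightarrow> bil A v w = 0) \<Longrightarrow> v \<in> N"
    using metabolicE[OF assms(1) A] by metis
  have bilB: "bil B v w = bil A (P *\<^sub>v v) (P *\<^sub>v w)" if "v \<in> carrier_vec n" "w \<in> carrier_vec n" for v w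
    unfolding P(5) by (rule bil_congruence[OF A P(1) that])
  show ?thesis
  proof (rule metabolicI[of B n "{v \<in> carrier_vec n. P *\<^sub>v v \<in> N}"])
    show "B \<in> sym_forms"
      using isometric_sym_forms[OF assms(2) metabolic_sym_forms[OF assms(1)]] .
    show "B \<in> carrier_mat n n" using isometric_dim[OF assms(2) A] .
    fix v assume v: "v \<in> carrier_vec n"
      and orth: "\<And>w. w \<in> {v \<in> carrier_vec n. P *\<^sub>v v \<in> N} \<Longrightarrow> bil B v w = 0"
    have "P *\<^sub>v v \<in> N"
    proof (rule N(3))
      fix u assume u: "u \<in> N"
      then have un: "u \<in> carrier_vec n" using N(1) by blast
      have PQ: "P *\<^sub>v (Q *\<^sub>v u) = u"
        using assoc_mult_mat_vec[OF P(1,2) un] P(3) un by simp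
      have Qu: "Q *\<^sub>v u \<in> carrier_vec n" using P(2) un by simp
      then have "bil B v (Q *\<^sub>v u) = 0"
        using orth[of "Q *\<^sub>v u"] u PQ by simp
      then show "bil A (P *\<^sub>v v) u = 0" using bilB[OF v Qu] PQ by simp
    qed (use P v in simp)
    with v show "v \<in> {v \<in> carrier_vec n. P *\<^sub>v v \<in> N}" by simp
  qed (use N(2) bilB in auto)
qed

lemma carrier_vec_append_cases:
  assumes "v \<in> carrier_vec (n + m)"
  obtains v1 v2 where "v1 \<in> carrier_vec n" "v2 \<in> carrier_vec m" "v = v1 @\<^sub>v v2"
  using that[of "vec_first v n" "vec_last v m"] vec_first_last_append[OF assms] by simp

lemma metabolic_orth_sum:
  assumes "metabolic A" "metabolic B"
  shows "metabolic (orth_sum A B)"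
proof -
  obtain n where A: "A \<in> carrier_mat n n"
    using sym_forms_carrier[OF metabolic_sym_forms[OF assms(1)]] .
  obtain m where B: "B \<in> carrier_mat m m"
    using sym_forms_carrier[OF metabolic_sym_forms[OF assms(2)]] .
  obtain N where N: "N \<subseteq> carrier_vec n" "\<And>v w. v \<in> N \<Longrightarrow> w \<in> N \<Longrightarrow> bil A v w = 0"
    "\<And>v. v \<in> carrier_vec n \<Longrightarrow> (\<And>w. w \<in> N \<Longrightarrow> bil A v w = 0) \<Longrightarrow> v \<in> N"
    using metabolicE[OF assms(1) A] by metis
  obtain M where M: "M \<subseteq> carrier_vec m" "\<And>v w. v \<in> M \<Longrightarrow> w \<in> M \<Longrightarrow> bil B v w = 0"
    "\<And>v. v \<in> carrier_vec m \<Longrightarrow> (\<And>w. w \<in> M \<Longrightarrow> bil B v w = 0) \<Longrightarrow> v \<in> M"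
    using metabolicE[OF assms(2) B] by metis
  have zero: "0\<^sub>v n \<in> N" "0\<^sub>v m \<in> M"
    using N(1) M(1) A B by (intro N(3) M(3); force)+
  let ?N = "{v @\<^sub>v w | v w. v \<in> N \<and> w \<in> M}"
  show ?thesis
  proof (rule metabolicI[of _ "n + m" ?N])
    show "orth_sum A B \<in> sym_forms"
      using orth_sum_sym_forms assms[THEN metabolic_sym_forms] .
    show "?N \<subseteq> carrier_vec (n + m)" using N(1) M(1) by auto
  next
    fix v w assume "v \<in> ?N" "w \<in> ?N"
    then obtain v1 v2 w1 w2 where vw: "v = v1 @\<^sub>v v2" "w = w1 @\<^sub>v w2"
      "v1 \<in> N" "v2 \<in> M" "w1 \<in> N" "w2 \<in> M" by blast
    then have "bil (orth_sum A B) v w = bil A v1 w1 + bil B v2 w2"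
      using bil_orth_sum[OF A B] N(1) M(1) by blast
    then show "bil (orth_sum A B) v w = 0" using N(2) M(2) vw by simp
  next
    fix v assume v: "v \<in> carrier_vec (n + m)"
      and orth: "\<And>w. w \<in> ?N \<Longrightarrow> bil (orth_sum A B) v w = 0"
    obtain v1 v2 where v12: "v1 \<in> carrier_vec n" "v2 \<in> carrier_vec m" "v = v1 @\<^sub>v v2"
      using carrier_vec_append_cases[OF v] .
    have "v1 \<in> N"
    proof (rule N(3)[OF v12(1)])
      fix w assume w: "w \<in> N"
      then have "bil (orth_sum A B) v (w @\<^sub>v 0\<^sub>v m) = 0" using orth zero by blast
      moreover have "bil (orth_sum A B) v (w @\<^sub>v 0\<^sub>v m) = bil A v1 w + bil B v2 (0\<^sub>v m)"
        unfolding v12(3) using v12 w N(1) by (intro bil_orth_sum[OF A B]) auto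
      moreover have "B *\<^sub>v 0\<^sub>v m = 0\<^sub>v m" using B by (intro eq_vecI) auto
      ultimately show "bil A v1 w = 0" using v12(2) by simp
    qed
    moreover have "v2 \<in> M"
    proof (rule M(3)[OF v12(2)])
      fix w assume w: "w \<in> M"
      then have "bil (orth_sum A B) v (0\<^sub>v n @\<^sub>v w) = 0" using orth zero by blast
      moreover have "bil (orth_sum A B) v (0\<^sub>v n @\<^sub>v w) = bil A v1 (0\<^sub>v n) + bil B v2 w"
        unfolding v12(3) using v12 w M(1) by (intro bil_orth_sum[OF A B]) auto
      moreover have "A *\<^sub>v 0\<^sub>v n = 0\<^sub>v n" using A by (intro eq_vecI) auto
      ultimately show "bil B v2 w = 0" using v12(1) by simp
    qed
    ultimately show "v \<in> ?N" using v12(3) by blast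
  qed (use A B in auto)
qed

lemma metabolic_zero: "metabolic (0\<^sub>m 0 0)"
proof (rule metabolicI[of _ 0 "carrier_vec 0"])
  show "(0\<^sub>m 0 0 :: 'a mat) \<in> sym_forms"
    by (auto simp: sym_forms_def intro!: invertible_matI[of _ 0 "0\<^sub>m 0 0"] eq_matI)
qed (auto simp: scalar_prod_def)

lemma metabolic_smult:
  assumes "metabolic A" "c \<noteq> 0"
  shows "metabolic (c \<cdot>\<^sub>m A)"
proof -
  obtain n where A: "A \<in> carrier_mat n n"
    using sym_forms_carrier[OF metabolic_sym_forms[OF assms(1)]] .
  obtain N where N: "N \<subseteq> carrier_vec n" "\<And>v w. v \<in> N \<Longrightarrow> w \<in> N \<Longrightarrow> bil A v w = 0"
    "\<And>v. v \<in> carrier_vec n \<Longrightarrow> (\<And>w. w \<in> N \<Longrightarrow> bil A v w = 0) \<Longrightarrow> v \<in> N"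
    using metabolicE[OF assms(1) A] by metis
  have c: "bil (c \<cdot>\<^sub>m A) v w = 0 \<longleftrightarrow> bil A v w = 0" if "v \<in> carrier_vec n" "w \<in> carrier_vec n" for v w
    using bil_smult_mat[OF A that] assms(2) by simp
  show ?thesis
  proof (rule metabolicI[of _ n N])
    show "c \<cdot>\<^sub>m A \<in> sym_forms" using smult_sym_forms metabolic_sym_forms assms by blast
    show "c \<cdot>\<^sub>m A \<in> carrier_mat n n" using A by simp
    show "bil (c \<cdot>\<^sub>m A) v w = 0" if "v \<in> N" "w \<in> N" for v w
      using N(2)[OF that] c[of v w] N(1) that by blast
    show "v \<in> N" if v: "v \<in> carrier_vec n" and o: "\<And>w. w \<in> N \<Longrightarrow> bil (c \<cdot>\<^sub>m A) v w = 0" for v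
      using N(3)[OF v] o c[OF v] N(1) by blast
  qed (rule N(1))
qed

text \<open>The diagonal is a Lagrangian of \<open>A \<oplus> -A\<close>.\<close>

lemma metabolic_orth_sum_uminus:
  assumes "A \<in> sym_forms"
  shows "metabolic (orth_sum A (- 1 \<cdot>\<^sub>m A))"
proof -
  obtain n A' where A: "A \<in> carrier_mat n n" "transpose_mat A = A"
    and A': "A' \<in> carrier_mat n n" "A * A' = 1\<^sub>m n" "A' * A = 1\<^sub>m n"
    using assms by (rule sym_formsE)
  have A2: "- 1 \<cdot>\<^sub>m A \<in> carrier_mat n n" using A(1) by simp
  have bil: "bil (orth_sum A (- 1 \<cdot>\<^sub>m A)) (y @\<^sub>v z) (w @\<^sub>v w) = bil A y w - bil A z w"
    if "y \<in> carrier_vec n" "z \<in> carrier_vec n" "w \<in> carrier_vec n" for y z w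
    using bil_orth_sum[OF A(1) A2 that(1,3,2,3)] bil_smult_mat[OF A(1) that(2,3), of "- 1"] by simp
  let ?N = "{v @\<^sub>v v | v. v \<in> carrier_vec n}"
  show ?thesis
  proof (rule metabolicI[of _ "n + n" ?N])
    show "orth_sum A (- 1 \<cdot>\<^sub>m A) \<in> sym_forms"
      by (intro orth_sum_sym_forms smult_sym_forms assms) simp
    show "orth_sum A (- 1 \<cdot>\<^sub>m A) \<in> carrier_mat (n + n) (n + n)"
      using A(1) A2 by simp
    show "bil (orth_sum A (- 1 \<cdot>\<^sub>m A)) v w = 0" if "v \<in> ?N" "w \<in> ?N" for v w
      using that bil by auto
  next
    fix v assume v: "v \<in> carrier_vec (n + n)"
      and orth: "\<And>w. w \<in> ?N \<Longrightarrow> bil (orth_sum A (- 1 \<cdot>\<^sub>m A)) v w = 0"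
    obtain y z where yz: "y \<in> carrier_vec n" "z \<in> carrier_vec n" "v = y @\<^sub>v z"
      using carrier_vec_append_cases[OF v] .
    have "bil A (y - z) w = 0" if w: "w \<in> carrier_vec n" for w
      using orth[of "w @\<^sub>v w"] w bil[OF yz(1,2) w] yz(3) minus_scalar_prod_distrib[OF yz(1,2), of "A *\<^sub>v w"] A(1)
      by auto
    then have yz0: "y - z = 0\<^sub>v n"
      using yz by (intro nondegenerate[OF A(1) A'(1,2)]) auto
    have "y = z"
    proof (rule eq_vecI)
      fix i assume "i < dim_vec z"
      then show "y $ i = z $ i" using arg_cong[OF yz0, of "\<lambda>v. v $ i"] yz(1,2) by simp
    qed (use yz in simp)
    then show "v \<in> ?N" using yz by blast
  qed auto
qed

text \<open>
  A subset that is maximal among those on which an alternating form vanishes is a Lagrangian: a vector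
  orthogonal to it may be added to it, because that vector is also orthogonal to itself.
\<close>

lemma metabolic_if_alternating:
  assumes "A \<in> sym_forms" "A \<in> carrier_mat n n"
    and "\<And>v. v \<in> carrier_vec n \<Longrightarrow> bil A v v = 0"
  shows "metabolic A"
proof -
  have A: "transpose_mat A = A" using assms(1) by (simp add: sym_forms_def)
  define S where "S = {N. N \<subseteq> carrier_vec n \<and> (\<forall>v\<in>N. \<forall>w\<in>N. bil A v w = 0)}"
  have "\<exists>M\<in>S. \<forall>U\<in>S. M \<subseteq> U \<longrightarrow> U = M"
  proof (rule subset_Zorn')
    fix C assume C: "subset.chain S C"
    have "bil A v w = 0" if v: "v \<in> \<Union>C" and w: "w \<in> \<Union>C" for v w
    proof -
      obtain U Y where UY: "v \<in> U" "U \<in> C" "w \<in> Y" "Y \<in> C" using v w by blast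
      then have "U \<subseteq> Y \<or> Y \<subseteq> U" using C by (auto simp: subset.chain_def)
      then have "\<exists>Z\<in>C. v \<in> Z \<and> w \<in> Z" using UY by blast
      then show ?thesis using C unfolding subset.chain_def S_def by blast
    qed
    then show "\<Union>C \<in> S" using C by (auto simp: S_def subset.chain_def)
  qed
  then obtain N where N: "N \<in> S" and max: "\<And>U. U \<in> S \<Longrightarrow> N \<subseteq> U \<Longrightarrow> U = N" by blast
  show ?thesis
  proof (rule metabolicI[OF assms(1,2)])
    show "N \<subseteq> carrier_vec n" "\<And>v w. v \<in> N \<Longrightarrow> w \<in> N \<Longrightarrow> bil A v w = 0"
      using N by (auto simp: S_def)
    fix v assume v: "v \<in> carrier_vec n" and orth: "\<And>w. w \<in> N \<Longrightarrow> bil A v w = 0"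
    have "bil A w v = 0" if "w \<in> N" for w
      using bil_commute[OF assms(2) A v, of w] orth[OF that] N that by (auto simp: S_def)
    then have "insert v N \<in> S"
      using N v orth assms(3)[OF v] by (simp add: S_def)
    then show "v \<in> N" using max by blast
  qed
qed

section \<open>Witt-trivial forms are isotropic\<close>

lemma sum_fun_apply: "(\<Sum>i\<in>I. f i) x = (\<Sum>i\<in>I. f i x)"
  for f :: "'b \<Rightarrow> 'c \<Rightarrow> 'a::field"
  by (induction I rule: infinite_finite_induct) simp_all

text \<open>
  A basis of \<open>S\<close> stays independent when \<open>z\<close> is added, so a linear functional can vanish on \<open>S\<close> and
  be 1 at \<open>z\<close>; its values at the unit vectors are the entries of \<open>w\<close>.  Vectors are encoded as
  functions on \<open>nat\<close> vanishing beyond the dimension, which makes the ambient vector space a whole type,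
  where values prescribed on an independent set extend linearly.
\<close>

lemma separating_vector:
  fixes S :: "'a::field vec set"
  assumes S: "S \<subseteq> carrier_vec n" "0\<^sub>v n \<in> S"
    and add: "\<And>u v. u \<in> S \<Longrightarrow> v \<in> S \<Longrightarrow> u + v \<in> S"
    and smult: "\<And>c u. u \<in> S \<Longrightarrow> c \<cdot>\<^sub>v u \<in> S"
    and z: "z \<in> carrier_vec n" "z \<notin> S"
  obtains w where "w \<in> carrier_vec n" "\<And>u. u \<in> S \<Longrightarrow> w \<bullet> u = 0" "w \<bullet> z \<noteq> 0"
proof -
  define scale :: "'a \<Rightarrow> (nat \<Rightarrow> 'a) \<Rightarrow> nat \<Rightarrow> 'a" where "scale c f = (\<lambda>i. c * f i)" for c f
  define emb :: "'a vec \<Rightarrow> nat \<Rightarrow> 'a" where "emb v = (\<lambda>i. if i < n then v $ i else 0)" for v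
  interpret V: vector_space scale
    by unfold_locales (auto simp: scale_def fun_eq_iff algebra_simps)
  interpret L: vector_space_pair scale "(*) :: 'a \<Rightarrow> 'a \<Rightarrow> 'a"
    by unfold_locales (auto simp: algebra_simps)
  have emb_inj: "u = v" if "emb u = emb v" "u \<in> carrier_vec n" "v \<in> carrier_vec n" for u v
  proof (rule eq_vecI)
    fix i assume "i < dim_vec v"
    then show "u $ i = v $ i" using fun_cong[OF that(1), of i] that(3) by (simp add: emb_def)
  qed (use that in simp)
  have "emb (0\<^sub>v n) = 0" by (auto simp: emb_def fun_eq_iff)
  moreover have "emb u + emb v = emb (u + v)" if "u \<in> carrier_vec n" "v \<in> carrier_vec n" for u v
    using that by (auto simp: emb_def fun_eq_iff)
  moreover have "scale c (emb u) = emb (c \<cdot>\<^sub>v u)" if "u \<in> carrier_vec n" for c u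
    using that by (auto simp: emb_def fun_eq_iff scale_def)
  ultimately have sub: "V.subspace (emb ` S)"
    unfolding V.subspace_def using S add smult by (auto simp: subset_iff intro!: rev_image_eqI)
  have zS: "emb z \<notin> emb ` S" using emb_inj[of z] z S(1) by blast
  obtain B where B: "B \<subseteq> emb ` S" "V.independent B" "emb ` S \<subseteq> V.span B"
    using V.maximal_independent_subset[of "emb ` S"] by blast
  have "V.span B \<subseteq> emb ` S" using V.span_minimal[OF B(1) sub] .
  then have "V.independent (insert (emb z) B)"
    using zS V.independent_insertI[OF _ B(2)] by blast
  then obtain g where g: "Vector_Spaces.linear scale (*) g"
    "\<forall>x\<in>insert (emb z) B. g x = (if x = emb z then 1 else 0)"
    using L.linear_independent_extend[of "insert (emb z) B" "\<lambda>x. if x = emb z then 1 else 0"] by blast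
  interpret g: Vector_Spaces.linear scale "(*) :: 'a \<Rightarrow> 'a \<Rightarrow> 'a" g by (rule g(1))
  have gB: "g x = 0" if "x \<in> B" for x
    using g(2) that zS B(1) by auto
  have gS: "g (emb u) = 0" if "u \<in> S" for u
    using L.linear_eq_0_on_span[OF g(1) gB] B(3) that by blast
  define e :: "nat \<Rightarrow> nat \<Rightarrow> 'a" where "e i = (\<lambda>j. if j = i then 1 else 0)" for i
  define w where "w = vec n (\<lambda>i. g (e i))"
  have wg: "w \<bullet> v = g (emb v)" if v: "v \<in> carrier_vec n" for v
  proof -
    have "emb v = (\<Sum>i\<in>{0..<n}. scale (v $ i) (e i))"
      by (rule ext) (simp add: sum_fun_apply emb_def scale_def e_def if_distrib[of "(*) _"] cong: if_cong)
    then have "g (emb v) = (\<Sum>i\<in>{0..<n}. v $ i * g (e i))"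
      by (simp add: g.sum g.scale)
    then show ?thesis using v by (simp add: scalar_prod_def w_def mult.commute)
  qed
  show thesis
  proof (rule that)
    show "w \<in> carrier_vec n" by (simp add: w_def)
    show "w \<bullet> u = 0" if "u \<in> S" for u using wg[of u] gS[OF that] S(1) that by auto
    show "w \<bullet> z \<noteq> 0" using wg[OF z(1)] g(2) by simp
  qed
qed

text \<open>
  Let \<open>N\<close> be a Lagrangian of \<open>A \<oplus> M\<close>, let \<open>L\<close> be one of \<open>M\<close>, and let \<open>x\<close> be a nonzero vector of
  \<open>A\<close>.  If \<open>x\<close> lies in \<open>N + L\<close>, then \<open>x - l\<close> is in \<open>N\<close> for some \<open>l\<close> in \<open>L\<close>; as \<open>x - l\<close> and \<open>l\<close>
  are isotropic and \<open>x\<close> is orthogonal to \<open>l\<close>, the vector \<open>x\<close> is isotropic.  Otherwise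
  some \<open>y + l\<close> orthogonal to \<open>N + L\<close> is not orthogonal to \<open>x\<close>; it lies in \<open>N\<close>, with \<open>l\<close> in \<open>L\<close>, and
  \<open>y\<close> is isotropic and nonzero.
\<close>

lemma isotropic_if_stably_metabolic:
  fixes A :: "'a::field mat"
  assumes A: "A \<in> sym_forms" "A \<in> carrier_mat n n" "n > 0"
    and M: "metabolic M" and AM: "metabolic (orth_sum A M)"
  obtains x where "x \<in> carrier_vec n" "x \<noteq> 0\<^sub>v n" "bil A x x = 0"
proof -
  obtain m where M2: "M \<in> carrier_mat m m"
    using sym_forms_carrier[OF metabolic_sym_forms[OF M]] .
  let ?G = "orth_sum A M"
  have Gc: "?G \<in> carrier_mat (n + m) (n + m)" using A(2) M2 by simp
  obtain G' where G: "transpose_mat ?G = ?G" "G' \<in> carrier_mat (n + m) (n + m)"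
    "?G * G' = 1\<^sub>m (n + m)" "G' * ?G = 1\<^sub>m (n + m)"
    using metabolic_sym_forms[OF AM] Gc by (auto simp: sym_forms_def elim!: invertible_matE)
  obtain L where L: "L \<subseteq> carrier_vec m" "\<And>v w. v \<in> L \<Longrightarrow> w \<in> L \<Longrightarrow> bil M v w = 0"
    "\<And>v. v \<in> carrier_vec m \<Longrightarrow> (\<And>w. w \<in> L \<Longrightarrow> bil M v w = 0) \<Longrightarrow> v \<in> L"
    using metabolicE[OF M M2] by metis
  obtain N where N: "N \<subseteq> carrier_vec (n + m)" "\<And>v w. v \<in> N \<Longrightarrow> w \<in> N \<Longrightarrow> bil ?G v w = 0"
    "\<And>v. v \<in> carrier_vec (n + m) \<Longrightarrow> (\<And>w. w \<in> N \<Longrightarrow> bil ?G v w = 0) \<Longrightarrow> v \<in> N"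
    using metabolicE[OF AM Gc] by metis
  have N_add: "u + v \<in> N" if "u \<in> N" "v \<in> N" for u v
    using that N(1,2) by (intro N(3)) (auto simp: bil_add_left[OF Gc] subset_iff)
  have N_smult: "c \<cdot>\<^sub>v u \<in> N" if "u \<in> N" for u c
    using that N(1,2) by (intro N(3)) (auto simp: bil_smult_left[OF Gc] subset_iff)
  have N_zero: "0\<^sub>v (n + m) \<in> N"
    using N(1) Gc by (intro N(3)) (auto simp: subset_iff)
  have L_add: "u + v \<in> L" if "u \<in> L" "v \<in> L" for u v
    using that L(1,2) by (intro L(3)) (auto simp: bil_add_left[OF M2] subset_iff)
  have L_smult: "c \<cdot>\<^sub>v u \<in> L" if "u \<in> L" for u c
    using that L(1,2) by (intro L(3)) (auto simp: bil_smult_left[OF M2] subset_iff)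
  have L_zero: "0\<^sub>v m \<in> L"
    using L(1) M2 by (intro L(3)) (auto simp: subset_iff)
  define x :: "'a vec" where "x = unit_vec n 0"
  have x: "x \<in> carrier_vec n" "x \<noteq> 0\<^sub>v n"
    using A(3) by (auto simp: x_def dest: arg_cong[of _ _ "\<lambda>v. v $ 0"])
  define z where "z = x @\<^sub>v 0\<^sub>v m"
  have z: "z \<in> carrier_vec (n + m)" using x(1) by (simp add: z_def)
  define S where "S = {u + (0\<^sub>v n @\<^sub>v l) | u l. u \<in> N \<and> l \<in> L}"
  show thesis
  proof (cases "z \<in> S")
    case True
    then obtain u l where ul: "z = u + (0\<^sub>v n @\<^sub>v l)" "u \<in> N" "l \<in> L" by (auto simp: S_def)
    have lc: "l \<in> carrier_vec m" using ul(3) L(1) by blast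
    obtain u1 u2 where u: "u1 \<in> carrier_vec n" "u2 \<in> carrier_vec m" "u = u1 @\<^sub>v u2"
      using carrier_vec_append_cases[of u n m] ul(2) N(1) by blast
    have "x @\<^sub>v 0\<^sub>v m = (u1 + 0\<^sub>v n) @\<^sub>v (u2 + l)"
      using ul(1) append_vec_add[OF u(1) zero_carrier_vec u(2) lc] by (simp add: z_def u(3))
    then have "x = u1" and u2l: "0\<^sub>v m = u2 + l"
      using append_vec_eq[of x n "u1 + 0\<^sub>v n"] x(1) u(1) by auto
    have "u2 = - 1 \<cdot>\<^sub>v l"
    proof (rule eq_vecI)
      fix i assume i: "i < dim_vec (- 1 \<cdot>\<^sub>v l)"
      then show "u2 $ i = (- 1 \<cdot>\<^sub>v l) $ i"
        using arg_cong[OF u2l, of "\<lambda>v. v $ i"] lc u(2) by (simp add: eq_neg_iff_add_eq_0)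
    qed (use lc u(2) in simp)
    then have "u2 \<in> L" using L_smult[OF ul(3)] by simp
    moreover have "bil ?G u u = bil A u1 u1 + bil M u2 u2"
      unfolding u(3) by (rule bil_orth_sum[OF A(2) M2 u(1,1,2,2)])
    ultimately have "bil A x x = 0" using N(2)[OF ul(2,2)] L(2) \<open>x = u1\<close> by simp
    then show thesis by (rule that[OF x])
  next
    case False
    obtain w where w: "w \<in> carrier_vec (n + m)" "\<And>u. u \<in> S \<Longrightarrow> w \<bullet> u = 0" "w \<bullet> z \<noteq> 0"
    proof (rule separating_vector[of S "n + m" z])
      show "S \<subseteq> carrier_vec (n + m)" using N(1) L(1) zero_carrier_vec[of n] by (fastforce simp: S_def)
      show "0\<^sub>v (n + m) \<in> S"
        unfolding S_def using N_zero L_zero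
        by (intro CollectI exI[of _ "0\<^sub>v (n + m)"] exI[of _ "0\<^sub>v m"]) (auto intro!: eq_vecI)
      show "u + v \<in> S" if uv: "u \<in> S" "v \<in> S" for u v
      proof -
        obtain u1 l1 u2 l2 where *: "u = u1 + (0\<^sub>v n @\<^sub>v l1)" "v = u2 + (0\<^sub>v n @\<^sub>v l2)"
          "u1 \<in> N" "u2 \<in> N" "l1 \<in> L" "l2 \<in> L" using uv by (auto simp: S_def)
        have dims: "dim_vec u1 = n + m" "dim_vec u2 = n + m" "dim_vec l1 = m" "dim_vec l2 = m"
          using *(3-6) N(1) L(1) by auto
        have "u + v = (u1 + u2) + (0\<^sub>v n @\<^sub>v (l1 + l2))"
          unfolding *(1,2) using dims by (intro eq_vecI) auto
        then show ?thesis using *(3-6) N_add L_add unfolding S_def by blast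
      qed
      show "c \<cdot>\<^sub>v u \<in> S" if u: "u \<in> S" for c u
      proof -
        obtain u1 l1 where *: "u = u1 + (0\<^sub>v n @\<^sub>v l1)" "u1 \<in> N" "l1 \<in> L" using u by (auto simp: S_def)
        have dims: "dim_vec u1 = n + m" "dim_vec l1 = m" using *(2,3) N(1) L(1) by auto
        have "c \<cdot>\<^sub>v u = c \<cdot>\<^sub>v u1 + (0\<^sub>v n @\<^sub>v (c \<cdot>\<^sub>v l1))"
          unfolding *(1) using dims by (intro eq_vecI) (auto simp: algebra_simps)
        then show ?thesis using *(2,3) N_smult L_smult unfolding S_def by blast
      qed
    qed (use z False in auto)
    define w' where "w' = G' *\<^sub>v w"
    have w'c: "w' \<in> carrier_vec (n + m)" using G(2) w(1) by (simp add: w'_def)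
    have w': "bil ?G w' u = w \<bullet> u" if u: "u \<in> carrier_vec (n + m)" for u
    proof -
      have "?G *\<^sub>v w' = w"
        unfolding w'_def using assoc_mult_mat_vec[OF Gc G(2) w(1)] G(3) w(1) by simp
      then have "bil ?G u w' = u \<bullet> w" by simp
      then show ?thesis
        using bil_commute[OF Gc G(1) w'c u] comm_scalar_prod[OF u w(1)] by simp
    qed
    obtain y l where yl: "y \<in> carrier_vec n" "l \<in> carrier_vec m" "w' = y @\<^sub>v l"
      using carrier_vec_append_cases[OF w'c] .
    have "w' \<in> N"
    proof (rule N(3)[OF w'c])
      fix u assume u: "u \<in> N"
      have "u = u + (0\<^sub>v n @\<^sub>v 0\<^sub>v m)"
        using u N(1) by (intro eq_vecI) auto
      then have "u \<in> S" unfolding S_def using u L_zero by blast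
      then show "bil ?G w' u = 0" using w' w(2) u N(1) by auto
    qed
    moreover have "l \<in> L"
    proof (rule L(3)[OF yl(2)])
      fix v assume v: "v \<in> L"
      then have vc: "v \<in> carrier_vec m" using L(1) by blast
      have "0\<^sub>v n @\<^sub>v v = 0\<^sub>v (n + m) + (0\<^sub>v n @\<^sub>v v)"
        using vc by (intro eq_vecI) auto
      then have "0\<^sub>v n @\<^sub>v v \<in> S" unfolding S_def using v N_zero by blast
      then have "bil ?G w' (0\<^sub>v n @\<^sub>v v) = 0" using w' w(2) vc by simp
      moreover have "bil ?G w' (0\<^sub>v n @\<^sub>v v) = bil A y (0\<^sub>v n) + bil M l v"
        unfolding yl(3) using bil_orth_sum[OF A(2) M2 yl(1) zero_carrier_vec yl(2) vc] .
      moreover have "A *\<^sub>v 0\<^sub>v n = 0\<^sub>v n" using A(2) by (intro eq_vecI) auto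
      ultimately show "bil M l v = 0" using yl(1) by simp
    qed
    ultimately have "bil A y y = 0"
      using bil_orth_sum[OF A(2) M2 yl(1,1,2,2)] N(2)[of w' w'] L(2)[of l l] yl(3) by simp
    moreover have "y \<noteq> 0\<^sub>v n"
    proof
      assume y0: "y = 0\<^sub>v n"
      have "bil ?G w' z = bil A y x + bil M l (0\<^sub>v m)"
        unfolding yl(3) z_def using bil_orth_sum[OF A(2) M2 yl(1) x(1) yl(2) zero_carrier_vec] .
      moreover have "M *\<^sub>v 0\<^sub>v m = 0\<^sub>v m" using M2 by (intro eq_vecI) auto
      ultimately have "bil ?G w' z = 0" using y0 yl(2) A(2) x(1) by simp
      then show False using w' w(3) z by simp
    qed
    ultimately show thesis using that yl(1) by blast
  qed
qed

section \<open>The Witt group\<close>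

lemma isometric_sym_forms_trans [trans]:
  assumes "isometric A B" "isometric B C" "A \<in> sym_forms"
  shows "isometric A C"
proof -
  obtain n where "A \<in> carrier_mat n n" using sym_forms_carrier[OF assms(3)] .
  with assms(1,2) show ?thesis by (rule isometric_trans)
qed

lemma isometric_sym_forms_sym: "isometric A B \<Longrightarrow> A \<in> sym_forms \<Longrightarrow> isometric B A"
  by (metis isometric_sym sym_forms_carrier)

lemma isometric_sym_forms_refl: "A \<in> sym_forms \<Longrightarrow> isometric A A"
  by (metis isometric_refl sym_forms_carrier)

lemma orth_sum_isometric_cong:
  assumes "isometric A A'" "isometric B B'" "A \<in> sym_forms" "B \<in> sym_forms"
  shows "isometric (orth_sum A B) (orth_sum A' B')"
  using assms by (metis isometric_orth_sum sym_forms_carrier)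

lemma orth_sum_isometric_commute:
  assumes "A \<in> sym_forms" "B \<in> sym_forms"
  shows "isometric (orth_sum A B) (orth_sum B A)"
  using assms by (metis isometric_orth_sum_commute sym_forms_carrier)

text \<open>
  Associativity being an equality of matrices, the exchange of the two middle summands is the only
  isometry that is involved.
\<close>

lemma orth_sum_interchange:
  assumes "A \<in> sym_forms" "B \<in> sym_forms" "C \<in> sym_forms" "D \<in> sym_forms"
  shows "isometric (orth_sum (orth_sum A B) (orth_sum C D)) (orth_sum (orth_sum A C) (orth_sum B D))"
proof -
  have "isometric (orth_sum (orth_sum B C) D) (orth_sum (orth_sum C B) D)"
    using assms by (intro orth_sum_isometric_cong orth_sum_isometric_commute isometric_sym_forms_refl
      orth_sum_sym_forms)
  then have "isometric (orth_sum A (orth_sum (orth_sum B C) D)) (orth_sum A (orth_sum (orth_sum C B) D))"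
    by (rule orth_sum_isometric_cong[OF isometric_sym_forms_refl[OF assms(1)] _ assms(1)])
      (intro orth_sum_sym_forms assms)
  then show ?thesis by (simp add: orth_sum_assoc)
qed

lemma witt_equivI:
  "metabolic M \<Longrightarrow> metabolic M' \<Longrightarrow> isometric (orth_sum A M) (orth_sum B M') \<Longrightarrow> witt_equiv A B"
  by (auto simp: witt_equiv_def)

lemma witt_equivE:
  assumes "witt_equiv A B"
  obtains M M' where "metabolic M" "metabolic M'" "M \<in> sym_forms" "M' \<in> sym_forms"
    "isometric (orth_sum A M) (orth_sum B M')"
  using assms metabolic_sym_forms unfolding witt_equiv_def by blast

lemma isometric_imp_witt_equiv: "isometric A B \<Longrightarrow> witt_equiv A B"
  by (rule witt_equivI[OF metabolic_zero metabolic_zero]) simp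

lemma witt_equiv_refl: "A \<in> sym_forms \<Longrightarrow> witt_equiv A A"
  by (rule isometric_imp_witt_equiv[OF isometric_sym_forms_refl])

lemma witt_equiv_sym:
  assumes "witt_equiv A B" "A \<in> sym_forms"
  shows "witt_equiv B A"
proof -
  obtain M M' where M: "metabolic M" "metabolic M'" "M \<in> sym_forms"
    "isometric (orth_sum A M) (orth_sum B M')"
    using witt_equivE[OF assms(1)] by metis
  show ?thesis
    by (rule witt_equivI[OF M(2,1) isometric_sym_forms_sym[OF M(4) orth_sum_sym_forms[OF assms(2) M(3)]]])
qed

lemma witt_equiv_trans:
  assumes "witt_equiv A B" "witt_equiv B C" and s: "A \<in> sym_forms" "B \<in> sym_forms" "C \<in> sym_forms"
  shows "witt_equiv A C"
proof -
  obtain M M' where M: "metabolic M" "metabolic M'" "M \<in> sym_forms" "M' \<in> sym_forms"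
    "isometric (orth_sum A M) (orth_sum B M')"
    using witt_equivE[OF assms(1)] by metis
  obtain N N' where N: "metabolic N" "metabolic N'" "N \<in> sym_forms" "N' \<in> sym_forms"
    "isometric (orth_sum B N) (orth_sum C N')"
    using witt_equivE[OF assms(2)] by metis
  note sf = s M(3,4) N(3,4) orth_sum_sym_forms
  have "isometric (orth_sum (orth_sum A M) N) (orth_sum (orth_sum B M') N)"
    by (intro orth_sum_isometric_cong M(5) isometric_sym_forms_refl sf)
  also have "isometric (orth_sum (orth_sum B M') N) (orth_sum (orth_sum B N) M')"
    unfolding orth_sum_assoc
    by (intro orth_sum_isometric_cong orth_sum_isometric_commute isometric_sym_forms_refl sf)
  also have "isometric (orth_sum (orth_sum B N) M') (orth_sum (orth_sum C N') M')"
    by (intro orth_sum_isometric_cong N(5) isometric_sym_forms_refl sf)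
  finally have "isometric (orth_sum A (orth_sum M N)) (orth_sum C (orth_sum N' M'))"
    by (simp add: orth_sum_assoc sf)
  then show ?thesis
    by (rule witt_equivI[OF metabolic_orth_sum[OF M(1) N(1)] metabolic_orth_sum[OF N(2) M(2)]])
qed

lemma witt_class_eq_iff:
  assumes "A \<in> sym_forms" "B \<in> sym_forms"
  shows "witt_class A = witt_class B \<longleftrightarrow> witt_equiv A B"
proof
  assume "witt_class A = witt_class B"
  moreover have "B \<in> witt_class B" using assms(2) by (simp add: witt_class_def witt_equiv_refl)
  ultimately show "witt_equiv A B" by (auto simp: witt_class_def)
next
  assume eq: "witt_equiv A B"
  show "witt_class A = witt_class B"
    unfolding witt_class_def
    using witt_equiv_trans[OF eq] witt_equiv_trans[OF witt_equiv_sym[OF eq assms(1)]] assms by blast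
qed

lemma in_witt_class: "A \<in> sym_forms \<Longrightarrow> A \<in> witt_class A"
  by (simp add: witt_class_def witt_equiv_refl)

lemma witt_class_eqI: "A \<in> sym_forms \<Longrightarrow> B \<in> witt_class A \<Longrightarrow> B \<in> sym_forms \<and> witt_class B = witt_class A"
  using witt_class_eq_iff[of A B] by (auto simp: witt_class_def)

lemma witt_class_isometric:
  "isometric A B \<Longrightarrow> A \<in> sym_forms \<Longrightarrow> witt_class A = witt_class B"
  using witt_class_eq_iff isometric_imp_witt_equiv isometric_sym_forms by metis

lemma witt_class_metabolic:
  assumes "metabolic A"
  shows "witt_class A = witt_class (0\<^sub>m 0 0)"
proof -
  have A: "A \<in> sym_forms" using metabolic_sym_forms[OF assms] .
  have "witt_equiv A (0\<^sub>m 0 0)"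
    by (rule witt_equivI[OF metabolic_zero assms]) (simp add: isometric_sym_forms_refl A)
  then show ?thesis using witt_class_eq_iff[OF A metabolic_sym_forms[OF metabolic_zero]] by simp
qed

lemma orth_sum_witt_equiv_cong:
  assumes "witt_equiv A A'" "witt_equiv B B'"
    and s: "A \<in> sym_forms" "A' \<in> sym_forms" "B \<in> sym_forms" "B' \<in> sym_forms"
  shows "witt_equiv (orth_sum A B) (orth_sum A' B')"
proof -
  obtain M M' where M: "metabolic M" "metabolic M'" "M \<in> sym_forms" "M' \<in> sym_forms"
    "isometric (orth_sum A M) (orth_sum A' M')"
    using witt_equivE[OF assms(1)] by metis
  obtain N N' where N: "metabolic N" "metabolic N'" "N \<in> sym_forms" "N' \<in> sym_forms"
    "isometric (orth_sum B N) (orth_sum B' N')"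
    using witt_equivE[OF assms(2)] by metis
  note sf = s M(3,4) N(3,4) orth_sum_sym_forms
  have "isometric (orth_sum (orth_sum A B) (orth_sum M N)) (orth_sum (orth_sum A M) (orth_sum B N))"
    by (intro orth_sum_interchange sf)
  also have "isometric \<dots> (orth_sum (orth_sum A' M') (orth_sum B' N'))"
    by (intro orth_sum_isometric_cong M(5) N(5) sf)
  also have "isometric \<dots> (orth_sum (orth_sum A' B') (orth_sum M' N'))"
    by (intro orth_sum_interchange sf)
  finally have "isometric (orth_sum (orth_sum A B) (orth_sum M N)) (orth_sum (orth_sum A' B') (orth_sum M' N'))"
    by (simp add: sf)
  then show ?thesis
    by (rule witt_equivI[OF metabolic_orth_sum[OF M(1) N(1)] metabolic_orth_sum[OF M(2) N(2)]])
qed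

definition W :: "'a::field mat set monoid" where
  "W = add_monoid witt_ring"

lemma carrier_W: "carrier W = witt_class ` sym_forms"
  by (simp add: W_def witt_ring_def)

lemma one_W: "\<one>\<^bsub>W\<^esub> = witt_class (0\<^sub>m 0 0)"
  by (simp add: W_def witt_ring_def)

lemma witt_class_closed: "A \<in> sym_forms \<Longrightarrow> witt_class A \<in> carrier W"
  by (simp add: carrier_W)

lemma W_cases:
  assumes "u \<in> carrier W"
  obtains A where "A \<in> sym_forms" "u = witt_class A"
  using assms unfolding carrier_W by blast

lemma mult_W:
  assumes "A \<in> sym_forms" "B \<in> sym_forms"
  shows "witt_class A \<otimes>\<^bsub>W\<^esub> witt_class B = witt_class (orth_sum A B)"
proof -
  have "witt_class (orth_sum A' B') = witt_class (orth_sum A B)"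
    if "A' \<in> witt_class A" "B' \<in> witt_class B" for A' B'
  proof -
    have *: "A' \<in> sym_forms" "B' \<in> sym_forms" "witt_equiv A A'" "witt_equiv B B'"
      using that by (auto simp: witt_class_def)
    have "witt_equiv (orth_sum A B) (orth_sum A' B')"
      by (rule orth_sum_witt_equiv_cong[OF *(3,4) assms(1) *(1) assms(2) *(2)])
    then show ?thesis
      using witt_class_eq_iff[OF orth_sum_sym_forms[OF assms] orth_sum_sym_forms[OF *(1,2)]] by simp
  qed
  moreover have "A \<in> witt_class A" "B \<in> witt_class B" using assms by (simp_all add: in_witt_class)
  ultimately have "(\<Union>A'\<in>witt_class A. \<Union>B'\<in>witt_class B. witt_class (orth_sum A' B')) = witt_class (orth_sum A B)"
    by blast
  then show ?thesis by (simp add: W_def witt_ring_def)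
qed

lemma witt_class_orth_sum_uminus:
  "A \<in> sym_forms \<Longrightarrow> witt_class A \<otimes>\<^bsub>W\<^esub> witt_class (- 1 \<cdot>\<^sub>m A) = \<one>\<^bsub>W\<^esub>"
  by (simp add: mult_W smult_sym_forms one_W witt_class_metabolic metabolic_orth_sum_uminus)

lemma comm_group_W: "comm_group (W :: 'a::field mat set monoid)"
proof (rule comm_groupI)
  note sf = orth_sum_sym_forms metabolic_sym_forms[OF metabolic_zero]
  fix x y z :: "'a mat set"
  assume x: "x \<in> carrier W"
  then obtain A where A: "A \<in> sym_forms" "x = witt_class A" by (rule W_cases)
  show "\<one>\<^bsub>W\<^esub> \<otimes>\<^bsub>W\<^esub> x = x"
    unfolding one_W A(2) by (subst mult_W) (use A(1) sf in auto)
  show "\<exists>y\<in>carrier W. y \<otimes>\<^bsub>W\<^esub> x = \<one>\<^bsub>W\<^esub>"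
  proof (rule bexI)
    have A': "- 1 \<cdot>\<^sub>m A \<in> sym_forms" using smult_sym_forms[OF A(1)] by simp
    show "witt_class (- 1 \<cdot>\<^sub>m A) \<in> carrier W" using witt_class_closed[OF A'] .
    have "witt_class (- 1 \<cdot>\<^sub>m A) \<otimes>\<^bsub>W\<^esub> witt_class A = witt_class A \<otimes>\<^bsub>W\<^esub> witt_class (- 1 \<cdot>\<^sub>m A)"
      unfolding mult_W[OF A' A(1)] mult_W[OF A(1) A']
      by (rule witt_class_isometric[OF orth_sum_isometric_commute[OF A' A(1)] sf(1)[OF A' A(1)]])
    then show "witt_class (- 1 \<cdot>\<^sub>m A) \<otimes>\<^bsub>W\<^esub> x = \<one>\<^bsub>W\<^esub>"
      using witt_class_orth_sum_uminus[OF A(1)] A(2) by metis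
  qed
  assume y: "y \<in> carrier W"
  then obtain B where B: "B \<in> sym_forms" "y = witt_class B" by (rule W_cases)
  show "x \<otimes>\<^bsub>W\<^esub> y \<in> carrier W"
    unfolding A(2) B(2) mult_W[OF A(1) B(1)] by (rule witt_class_closed[OF sf(1)[OF A(1) B(1)]])
  show "x \<otimes>\<^bsub>W\<^esub> y = y \<otimes>\<^bsub>W\<^esub> x"
    unfolding A(2) B(2) mult_W[OF A(1) B(1)] mult_W[OF B(1) A(1)]
    by (rule witt_class_isometric[OF orth_sum_isometric_commute[OF A(1) B(1)] sf(1)[OF A(1) B(1)]])
  assume z: "z \<in> carrier W"
  then obtain C where C: "C \<in> sym_forms" "z = witt_class C" by (rule W_cases)
  show "x \<otimes>\<^bsub>W\<^esub> y \<otimes>\<^bsub>W\<^esub> z = x \<otimes>\<^bsub>W\<^esub> (y \<otimes>\<^bsub>W\<^esub> z)"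
    unfolding A(2) B(2) C(2) mult_W[OF A(1) B(1)] mult_W[OF B(1) C(1)]
      mult_W[OF sf(1)[OF A(1) B(1)] C(1)] mult_W[OF A(1) sf(1)[OF B(1) C(1)]] orth_sum_assoc ..
next
  show "\<one>\<^bsub>W\<^esub> \<in> carrier (W :: 'a mat set monoid)"
    unfolding one_W by (rule witt_class_closed[OF metabolic_sym_forms[OF metabolic_zero]])
qed

lemma W_disjoint: "disjoint (carrier (W :: 'a::field mat set monoid))" "{} \<notin> carrier (W :: 'a mat set monoid)"
proof -
  show "disjoint (carrier (W :: 'a mat set monoid))"
  proof (rule disjointI)
    fix u v :: "'a mat set" assume "u \<in> carrier W" "v \<in> carrier W" and ne: "u \<noteq> v"
    then obtain A B where AB: "A \<in> sym_forms" "u = witt_class A" "B \<in> sym_forms" "v = witt_class B"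
      using W_cases by metis
    show "u \<inter> v = {}"
      using witt_class_eqI[OF AB(1)] witt_class_eqI[OF AB(3)] ne AB(2,4) by blast
  qed
  show "{} \<notin> carrier (W :: 'a mat set monoid)"
    unfolding carrier_W using in_witt_class by fastforce
qed

section \<open>Scaling and rank one forms\<close>

text \<open>
  Multiplication by the rank one class of a unit \<open>c\<close>, given by scaling Gram matrices instead of the
  tensor product.
\<close>

definition sc :: "'a::field \<Rightarrow> 'a mat set \<Rightarrow> 'a mat set" where
  "sc c u = (\<Union>A\<in>u. witt_class (c \<cdot>\<^sub>m A))"

lemma smult_witt_equiv:
  assumes "witt_equiv A B" "A \<in> sym_forms" "B \<in> sym_forms" "c \<noteq> 0"
  shows "witt_equiv (c \<cdot>\<^sub>m A) (c \<cdot>\<^sub>m B)"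
proof -
  obtain M M' where M: "metabolic M" "metabolic M'" "M \<in> sym_forms" "M' \<in> sym_forms"
    "isometric (orth_sum A M) (orth_sum B M')"
    using witt_equivE[OF assms(1)] by metis
  obtain n where A: "A \<in> carrier_mat n n" using sym_forms_carrier[OF assms(2)] .
  obtain m where B: "B \<in> carrier_mat m m" using sym_forms_carrier[OF assms(3)] .
  obtain k where k: "M \<in> carrier_mat k k" using sym_forms_carrier[OF M(3)] .
  obtain l where l: "M' \<in> carrier_mat l l" using sym_forms_carrier[OF M(4)] .
  have "isometric (c \<cdot>\<^sub>m orth_sum A M) (c \<cdot>\<^sub>m orth_sum B M')"
    by (rule isometric_smult[OF M(5) orth_sum_carrier[OF A k]])
  then show ?thesis
    unfolding orth_sum_smult[OF A k] orth_sum_smult[OF B l]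
    by (rule witt_equivI[OF metabolic_smult[OF M(1) assms(4)] metabolic_smult[OF M(2) assms(4)]])
qed

lemma sc_witt_class:
  assumes "A \<in> sym_forms" "c \<noteq> 0"
  shows "sc c (witt_class A) = witt_class (c \<cdot>\<^sub>m A)"
proof -
  have "witt_class (c \<cdot>\<^sub>m B) = witt_class (c \<cdot>\<^sub>m A)" if "B \<in> witt_class A" for B
  proof -
    have B: "B \<in> sym_forms" "witt_equiv A B" using that by (auto simp: witt_class_def)
    show ?thesis
      using witt_class_eq_iff[OF smult_sym_forms[OF assms] smult_sym_forms[OF B(1) assms(2)]]
        smult_witt_equiv[OF B(2) assms(1) B(1) assms(2)] by simp
  qed
  then show ?thesis using in_witt_class[OF assms(1)] unfolding sc_def by blast
qed

lemma sc_closed: "u \<in> carrier W \<Longrightarrow> c \<noteq> 0 \<Longrightarrow> sc c u \<in> carrier W"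
  by (elim W_cases) (simp only: sc_witt_class witt_class_closed smult_sym_forms simp_thms)

lemma sc_hom: "c \<noteq> 0 \<Longrightarrow> sc c \<in> hom W W"
proof (rule homI)
  fix x y :: "'a mat set" assume c: "c \<noteq> 0" and x: "x \<in> carrier W" and y: "y \<in> carrier W"
  obtain A where A: "A \<in> sym_forms" "x = witt_class A" using W_cases[OF x] .
  obtain B where B: "B \<in> sym_forms" "y = witt_class B" using W_cases[OF y] .
  obtain n where n: "A \<in> carrier_mat n n" using sym_forms_carrier[OF A(1)] .
  obtain m where m: "B \<in> carrier_mat m m" using sym_forms_carrier[OF B(1)] .
  have "sc c (x \<otimes>\<^bsub>W\<^esub> y) = witt_class (c \<cdot>\<^sub>m orth_sum A B)"
    unfolding A(2) B(2) mult_W[OF A(1) B(1)] by (rule sc_witt_class[OF orth_sum_sym_forms[OF A(1) B(1)] c])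
  also have "\<dots> = sc c x \<otimes>\<^bsub>W\<^esub> sc c y"
    unfolding A(2) B(2) sc_witt_class[OF A(1) c] sc_witt_class[OF B(1) c]
      mult_W[OF smult_sym_forms[OF A(1) c] smult_sym_forms[OF B(1) c]] orth_sum_smult[OF n m] ..
  finally show "sc c (x \<otimes>\<^bsub>W\<^esub> y) = sc c x \<otimes>\<^bsub>W\<^esub> sc c y" .
qed (rule sc_closed)

lemma sc_sc:
  assumes "u \<in> carrier W" "c \<noteq> 0" "b \<noteq> 0"
  shows "sc c (sc b u) = sc (c * b) u"
proof -
  obtain A where A: "A \<in> sym_forms" "u = witt_class A" using W_cases[OF assms(1)] .
  have cb: "c * b \<noteq> 0" using assms(2,3) by simp
  show ?thesis
    unfolding A(2) sc_witt_class[OF A(1) assms(3)] sc_witt_class[OF A(1) cb]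
      sc_witt_class[OF smult_sym_forms[OF A(1) assms(3)] assms(2)] smult_smult ..
qed

lemma sc_square:
  assumes "u \<in> carrier W" "c \<noteq> 0"
  shows "sc (c * c) u = u"
proof -
  obtain A where A: "A \<in> sym_forms" "u = witt_class A" using W_cases[OF assms(1)] .
  obtain n where n: "A \<in> carrier_mat n n" using sym_forms_carrier[OF A(1)] .
  have cb: "c * c \<noteq> 0" using assms(2) by simp
  show ?thesis
    unfolding A(2) sc_witt_class[OF A(1) cb]
    by (rule witt_class_isometric[OF isometric_smult_square[OF n assms(2)] A(1), symmetric])
qed

lemma sc_uminus:
  assumes "u \<in> carrier W" "c \<noteq> 0"
  shows "sc c u \<otimes>\<^bsub>W\<^esub> sc (- c) u = \<one>\<^bsub>W\<^esub>"
proof -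
  obtain A where A: "A \<in> sym_forms" "u = witt_class A" using W_cases[OF assms(1)] .
  have c: "- c \<noteq> 0" using assms(2) by simp
  have "- c \<cdot>\<^sub>m A = - 1 \<cdot>\<^sub>m (c \<cdot>\<^sub>m A)" by (simp add: smult_smult)
  then show ?thesis
    unfolding A(2) sc_witt_class[OF A(1) assms(2)] sc_witt_class[OF A(1) c]
    using witt_class_orth_sum_uminus[OF smult_sym_forms[OF A(1) assms(2)]] by simp
qed

abbreviation mat1 :: "'a \<Rightarrow> 'a mat" where
  "mat1 a \<equiv> mat 1 1 (\<lambda>_. a)"

lemma mat1_sym_forms: "a \<noteq> 0 \<Longrightarrow> mat1 (a :: 'a::field) \<in> sym_forms"
  unfolding sym_forms_def
  by (auto intro!: invertible_matI[of _ 1 "mat1 (inverse a)"] eq_matI simp: scalar_prod_def)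

lemma rank_one_closed: "a \<noteq> 0 \<Longrightarrow> rank_one a \<in> carrier W"
  unfolding rank_one_def by (rule witt_class_closed[OF mat1_sym_forms])

lemma sc_rank_one:
  assumes "a \<noteq> 0" "c \<noteq> 0"
  shows "sc c (rank_one a) = rank_one (c * a)"
proof -
  have "c \<cdot>\<^sub>m mat1 a = mat1 (c * a)" by (rule eq_matI) auto
  then show ?thesis
    unfolding rank_one_def sc_witt_class[OF mat1_sym_forms[OF assms(1)] assms(2)] by simp
qed

text \<open>In the orthogonal basis \<open>(1, 1), (b, -a)\<close> the form \<open>\<langle>a\<rangle> + \<langle>b\<rangle>\<close> has the stated diagonal entries.\<close>

lemma rank_one_add:
  assumes "a \<noteq> 0" "b \<noteq> 0" "a + b \<noteq> 0"
  shows "rank_one a \<otimes>\<^bsub>W\<^esub> rank_one b = rank_one (a + b) \<otimes>\<^bsub>W\<^esub> rank_one ((a + b) * a * b)"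
proof -
  have ab: "(a + b) * a * b \<noteq> 0" using assms by simp
  note sf = assms[THEN mat1_sym_forms] mat1_sym_forms[OF ab]
  define P where "P = mat 2 2 (\<lambda>(i, j). if j = 0 then 1 else if i = 0 then b else - a)"
  define r where "r = inverse (a + b)"
  have r: "a * r + b * r = 1"
    using assms(3) by (simp add: r_def flip: distrib_right)
  define Q where "Q = mat 2 2 (\<lambda>(i, j). if i = 0 then if j = 0 then a * r else b * r
     else if j = 0 then r else - r)"
  have two: "{0..<2::nat} = {0, 1}" by auto
  have lt2: "i = 0 \<or> i = 1" if "i < 2" for i :: nat using that by auto
  have D: "orth_sum (mat1 x) (mat1 y) = mat 2 2 (\<lambda>(i, j). if i = j then if i = 0 then x else y else 0)" for x y :: 'a
    by (rule eq_matI) (auto simp: orth_sum_def dest!: lt2)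
  have "isometric (orth_sum (mat1 a) (mat1 b)) (orth_sum (mat1 (a + b)) (mat1 ((a + b) * a * b)))"
  proof (rule isometricI[of _ 2 P Q])
    show "P * Q = 1\<^sub>m 2"
      using r by (intro eq_matI) (auto simp: P_def Q_def scalar_prod_def two algebra_simps dest!: lt2)
    show "Q * P = 1\<^sub>m 2"
      using r by (intro eq_matI) (auto simp: P_def Q_def scalar_prod_def two algebra_simps dest!: lt2)
    show "orth_sum (mat1 (a + b)) (mat1 ((a + b) * a * b)) = transpose_mat P * orth_sum (mat1 a) (mat1 b) * P"
      unfolding D by (rule eq_matI) (auto simp: P_def scalar_prod_def two algebra_simps dest!: lt2)
    show "orth_sum (mat1 a) (mat1 b) \<in> carrier_mat 2 2" unfolding D by simp
  qed (simp_all add: P_def Q_def)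
  then show ?thesis
    unfolding rank_one_def mult_W[OF sf(1,2)] mult_W[OF sf(3,4)]
    by (rule witt_class_isometric) (rule orth_sum_sym_forms[OF sf(1,2)])
qed

section \<open>Generation by rank one forms\<close>

text \<open>
  The determinant of an orthogonal sum is the product of the determinants, so a summand of an
  invertible matrix is invertible.
\<close>

lemma orth_sum_sym_formsD:
  fixes A :: "'a::field mat"
  assumes "orth_sum A B \<in> sym_forms" "A \<in> carrier_mat n n" "B \<in> carrier_mat m m"
  shows "B \<in> sym_forms"
proof -
  have c: "orth_sum A B \<in> carrier_mat (n + m) (n + m)" using assms(2,3) by simp
  have inv: "invertible_mat (orth_sum A B)" and tr: "transpose_mat (orth_sum A B) = orth_sum A B"
    using assms(1) by (simp_all add: sym_forms_def)
  obtain G where G: "G \<in> carrier_mat (n + m) (n + m)" "orth_sum A B * G = 1\<^sub>m (n + m)"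
    using invertible_matE[OF inv c] .
  have "det (orth_sum A B) * det G = 1"
    using det_mult[OF c G(1)] G(2) by simp
  moreover have "det (orth_sum A B) = det A * det B"
    using assms(2,3) det_four_block_mat_upper_right_zero[OF assms(2) refl zero_carrier_mat assms(3)]
    by (simp add: orth_sum_def)
  ultimately have "det B \<noteq> 0" by auto
  then have "B \<in> Units (ring_mat TYPE('a) m ())"
    by (rule det_non_zero_imp_unit[OF assms(3)])
  then obtain B' where "B' \<in> carrier_mat m m" "B * B' = 1\<^sub>m m" "B' * B = 1\<^sub>m m"
    by (auto simp: Units_def ring_mat_simps)
  then have "invertible_mat B" using invertible_matI[OF assms(3)] by blast
  moreover have "transpose_mat B = B"
  proof (rule eq_matI)
    fix i j assume ij: "i < dim_row B" "j < dim_col B"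
    then have "transpose_mat (orth_sum A B) $$ (n + i, n + j) = orth_sum A B $$ (n + i, n + j)"
      using tr by simp
    then show "transpose_mat B $$ (i, j) = B $$ (i, j)"
      using ij assms(2,3) by (simp add: orth_sum_def)
  qed (use assms(3) in auto)
  ultimately show ?thesis by (simp add: sym_forms_def)
qed

lemma exists_basis_with_first_vector:
  fixes x :: "'a::field vec"
  assumes x: "x \<in> carrier_vec n" and j: "j < n" "x $ j \<noteq> 0"
  obtains P Q where "P \<in> carrier_mat n n" "Q \<in> carrier_mat n n" "P * Q = 1\<^sub>m n" "Q * P = 1\<^sub>m n"
    "P *\<^sub>v unit_vec n 0 = x"
proof -
  \<comment> \<open>the basis vector of index \<open>j\<close> is replaced by \<open>x\<close>, which is then moved to the front\<close>
  define \<sigma> :: "nat \<Rightarrow> nat" where "\<sigma> k = (if k = 0 then j else if k = j then 0 else k)" for k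
  have \<sigma>: "\<sigma> k < n" "\<sigma> (\<sigma> k) = k" "\<sigma> k = 0 \<longleftrightarrow> k = j" if "k < n" for k
    using that j(1) by (auto simp: \<sigma>_def)
  define P where "P = mat n n (\<lambda>(i, k). (if k = 0 then x $ i else 0) + (if k = \<sigma> i then if k = 0 then 0 else 1 else 0))"
  define Q where "Q = mat n n (\<lambda>(k, i). if k = 0 then (if i = j then 1 / x $ j else 0)
     else (if i = \<sigma> k then 1 else 0) - (if i = j then x $ \<sigma> k / x $ j else 0))"
  have PQ: "P * Q = 1\<^sub>m n"
  proof (rule eq_matI)
    fix i l assume "i < dim_row (1\<^sub>m n :: 'a mat)" "l < dim_col (1\<^sub>m n :: 'a mat)"
    then have il: "i < n" "l < n" by simp_all
    have "(P * Q) $$ (i, l) = (\<Sum>k\<in>{0..<n}. P $$ (i, k) * Q $$ (k, l))"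
      using il by (simp add: P_def Q_def scalar_prod_def)
    also have "\<dots> = (\<Sum>k\<in>{0..<n}. (if k = 0 then x $ i * Q $$ (0, l) else 0)
        + (if k = \<sigma> i then if k = 0 then 0 else Q $$ (k, l) else 0))"
      by (rule sum.cong) (use il in \<open>auto simp: P_def distrib_right\<close>)
    also have "\<dots> = x $ i * Q $$ (0, l) + (if \<sigma> i = 0 then 0 else Q $$ (\<sigma> i, l))"
      using il \<sigma>(1)[OF il(1)] by (simp add: sum.distrib)
    also have "\<dots> = 1\<^sub>m n $$ (i, l)"
      using il \<sigma>[OF il(1)] j by (auto simp: Q_def)
    finally show "(P * Q) $$ (i, l) = 1\<^sub>m n $$ (i, l)" .
  qed (simp_all add: P_def Q_def)
  have c: "P \<in> carrier_mat n n" "Q \<in> carrier_mat n n" by (simp_all add: P_def Q_def)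
  have "P *\<^sub>v unit_vec n 0 = x"
    using x j(1) by (intro eq_vecI) (auto simp: P_def)
  then show thesis using that c PQ mat_mult_left_right_inverse[OF c PQ] by blast
qed

text \<open>One step of symmetric Gaussian elimination.\<close>

lemma isometric_schur:
  fixes B :: "'a::field mat"
  assumes B: "B \<in> carrier_mat (1 + m) (1 + m)" "transpose_mat B = B" and q: "B $$ (0, 0) = q" "q \<noteq> 0"
  obtains C where "C \<in> carrier_mat m m" "isometric B (orth_sum (mat1 q) C)"
proof -
  have Bsym: "B $$ (i, j) = B $$ (j, i)" if "i < 1 + m" "j < 1 + m" for i j
    using arg_cong[OF B(2), of "\<lambda>M. M $$ (i, j)"] that B(1) by simp
  define b where "b = mat 1 m (\<lambda>(i, j). B $$ (0, Suc j))"
  define D where "D = mat m m (\<lambda>(i, j). B $$ (Suc i, Suc j))"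
  define r where "r = mat 1 m (\<lambda>(i, j). - B $$ (0, Suc j) / q)"
  have c: "b \<in> carrier_mat 1 m" "D \<in> carrier_mat m m" "r \<in> carrier_mat 1 m"
    "transpose_mat b \<in> carrier_mat m 1" "transpose_mat r \<in> carrier_mat m 1"
    "mat1 q \<in> carrier_mat 1 1" "- r \<in> carrier_mat 1 m"
    by (simp_all add: b_def D_def r_def)
  have Bb: "B = four_block_mat (mat1 q) b (transpose_mat b) D"
    using B(1) Bsym q(1) by (intro eq_matI) (auto simp: b_def D_def)
  define P where "P = four_block_mat (1\<^sub>m 1) r (0\<^sub>m m 1) (1\<^sub>m m)"
  define Q where "Q = four_block_mat (1\<^sub>m 1) (- r) (0\<^sub>m m 1) (1\<^sub>m m)"
  have Pc: "P \<in> carrier_mat (1 + m) (1 + m)" "Q \<in> carrier_mat (1 + m) (1 + m)"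
    unfolding P_def Q_def by (intro four_block_carrier_mat one_carrier_mat)+
  have Pt: "transpose_mat P = four_block_mat (1\<^sub>m 1) (0\<^sub>m 1 m) (transpose_mat r) (1\<^sub>m m)"
    unfolding P_def by (subst transpose_four_block_mat[of _ 1 1 _ m _ m]) (use c in auto)
  have "- 0\<^sub>m m m = (0\<^sub>m m m :: 'a mat)" by (rule eq_matI) auto
  then have PQ: "P * Q = 1\<^sub>m (1 + m)"
    unfolding P_def Q_def
    by (subst mult_four_block_mat[of _ 1 1 _ m _ m _ _ 1 _ m])
      (use c four_block_one_mat[of 1 m] in \<open>auto simp: uminus_l_inv_mat\<close>)
  have qr: "mat1 q * r + b = 0\<^sub>m 1 m"
    using q(2) by (intro eq_matI) (auto simp: r_def b_def scalar_prod_def)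
  have rq: "transpose_mat r * mat1 q + transpose_mat b = 0\<^sub>m m 1"
    using q(2) by (intro eq_matI) (auto simp: r_def b_def scalar_prod_def)
  let ?C = "(transpose_mat r * b + D)"
  have "transpose_mat P * B = four_block_mat (mat1 q) b (0\<^sub>m m 1) ?C"
    unfolding Pt Bb
    by (subst mult_four_block_mat[of _ 1 1 _ m _ m _ _ 1 _ m]) (use c rq in auto)
  then have "transpose_mat P * B * P = four_block_mat (mat1 q) (0\<^sub>m 1 m) (0\<^sub>m m 1) ?C"
    unfolding P_def
    by (simp only:, subst mult_four_block_mat[of _ 1 1 _ m _ m _ _ 1 _ m]) (use c qr in auto)
  also have "\<dots> = orth_sum (mat1 q) ?C"
    using c by (simp add: orth_sum_def)
  finally have "orth_sum (mat1 q) ?C = transpose_mat P * B * P" ..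
  then have "isometric B (orth_sum (mat1 q) ?C)"
    by (rule isometricI[OF B(1) Pc PQ mat_mult_left_right_inverse[OF Pc PQ]])
  moreover have "?C \<in> carrier_mat m m" using c by auto
  ultimately show thesis using that by blast
qed

lemma split_off_rank_one:
  assumes A: "A \<in> sym_forms" "A \<in> carrier_mat n n" and x: "x \<in> carrier_vec n" "bil A x x \<noteq> 0"
  obtains m C where "n = Suc m" "C \<in> carrier_mat m m" "C \<in> sym_forms"
    "isometric A (orth_sum (mat1 (bil A x x)) C)"
proof -
  have "\<exists>j<n. x $ j \<noteq> 0"
  proof (rule ccontr)
    assume "\<not> (\<exists>j<n. x $ j \<noteq> 0)"
    then have "x = 0\<^sub>v n" using x(1) by (intro eq_vecI) auto
    then show False using x A(2) by simp
  qed
  then obtain j where j: "j < n" "x $ j \<noteq> 0" by blast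
  obtain m where m: "n = Suc m" using j(1) by (cases n) auto
  obtain P Q where P: "P \<in> carrier_mat n n" "Q \<in> carrier_mat n n" "P * Q = 1\<^sub>m n" "Q * P = 1\<^sub>m n"
    "P *\<^sub>v unit_vec n 0 = x"
    using exists_basis_with_first_vector[OF x(1) j] .
  define B where "B = transpose_mat P * A * P"
  have AB: "isometric A B" by (rule isometricI[OF A(2) P(1-4) B_def])
  have B: "B \<in> sym_forms" "B \<in> carrier_mat n n"
    using isometric_sym_forms[OF AB A(1)] isometric_dim[OF AB A(2)] .
  have "B $$ (0, 0) = bil B (unit_vec n 0) (unit_vec n 0)"
    using B(2) m by simp
  also have "\<dots> = bil A x x"
    unfolding B_def using bil_congruence[OF A(2) P(1), of "unit_vec n 0" "unit_vec n 0"] P(5) by simp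
  finally have B00: "B $$ (0, 0) = bil A x x" .
  have "B \<in> carrier_mat (1 + m) (1 + m)" "transpose_mat B = B"
    using B m by (simp_all add: sym_forms_def)
  then obtain C where C: "C \<in> carrier_mat m m" "isometric B (orth_sum (mat1 (bil A x x)) C)"
    using isometric_schur[OF _ _ B00 x(2)] by blast
  have "orth_sum (mat1 (bil A x x)) C \<in> sym_forms" using isometric_sym_forms[OF C(2) B(1)] .
  then have "C \<in> sym_forms" using orth_sum_sym_formsD[of _ C 1 m] C(1) by simp
  then show thesis using that[OF m C(1)] isometric_sym_forms_trans[OF AB C(2) A(1)] by blast
qed

text \<open>
  A form with a vector \<open>x\<close> such that \<open>bil A x x \<noteq> 0\<close> splits off a rank one form, and all other forms
  are alternating, hence metabolic and zero in \<open>W\<close>.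
\<close>

lemma W_induct [consumes 1, case_names zero add]:
  assumes u: "u \<in> carrier (W :: 'a::field mat set monoid)"
    and zero: "R \<one>\<^bsub>W\<^esub>"
    and add: "\<And>a u. a \<noteq> 0 \<Longrightarrow> u \<in> carrier W \<Longrightarrow> R u \<Longrightarrow> R (rank_one a \<otimes>\<^bsub>W\<^esub> u)"
  shows "R u"
proof -
  have "R (witt_class A)" if "A \<in> sym_forms" "A \<in> carrier_mat n n" for n and A :: "'a mat"
    using that
  proof (induction n arbitrary: A rule: less_induct)
    case (less n)
    show ?case
    proof (cases "\<forall>x\<in>carrier_vec n. bil A x x = 0")
      case True
      then have "metabolic A" using metabolic_if_alternating[OF less.prems] by blast
      then show ?thesis using zero by (simp add: witt_class_metabolic one_W)
    next
      case False
      then obtain x where x: "x \<in> carrier_vec n" "bil A x x \<noteq> 0" by blast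
      obtain m C where C: "n = Suc m" "C \<in> carrier_mat m m" "C \<in> sym_forms"
        "isometric A (orth_sum (mat1 (bil A x x)) C)"
        using split_off_rank_one[OF less.prems x] .
      have "witt_class A = rank_one (bil A x x) \<otimes>\<^bsub>W\<^esub> witt_class C"
        unfolding rank_one_def mult_W[OF mat1_sym_forms[OF x(2)] C(3)]
        by (rule witt_class_isometric[OF C(4) less.prems(1)])
      then show ?thesis
        using add[OF x(2) witt_class_closed[OF C(3)]] less.IH[of m C] C by simp
    qed
  qed
  then show ?thesis using W_cases[OF u] sym_forms_carrier by metis
qed

section \<open>Elementary symmetric functions of rank one forms\<close>

interpretation W: comm_group W
  by (rule comm_group_W)

abbreviation units :: "'a::zero list \<Rightarrow> bool" where
  "units xs \<equiv> 0 \<notin> set xs"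

text \<open>
  \<open>esym k [a1, \<dots>, an]\<close> is the class of the exterior power \<open>\<Lambda>\<^sup>k\<close> of \<open>\<langle>a1\<rangle> + \<dots> + \<langle>an\<rangle>\<close>.
\<close>

fun esym :: "nat \<Rightarrow> 'a::field list \<Rightarrow> 'a mat set" where
  "esym 0 xs = rank_one 1"
| "esym (Suc k) [] = \<one>\<^bsub>W\<^esub>"
| "esym (Suc k) (x # xs) = esym (Suc k) xs \<otimes>\<^bsub>W\<^esub> sc x (esym k xs)"

lemma esym_closed [simp]: "units xs \<Longrightarrow> esym k xs \<in> carrier W"
  by (induction k xs rule: esym.induct) (auto simp: rank_one_closed sc_closed)

lemma sc_one [simp]: "c \<noteq> 0 \<Longrightarrow> sc c \<one>\<^bsub>W\<^esub> = \<one>\<^bsub>W\<^esub>"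
  using hom_one[OF sc_hom W.is_group W.is_group] .

lemma sc_mult: "c \<noteq> 0 \<Longrightarrow> u \<in> carrier W \<Longrightarrow> v \<in> carrier W \<Longrightarrow> sc c (u \<otimes>\<^bsub>W\<^esub> v) = sc c u \<otimes>\<^bsub>W\<^esub> sc c v"
  using hom_mult[OF sc_hom] .

text \<open>
  The relation \<open>\<langle>a\<rangle> + \<langle>b\<rangle> = \<langle>a + b\<rangle> + \<langle>(a + b) a b\<rangle>\<close> may be multiplied by any form, because
  multiplying it by \<open>\<langle>c\<rangle>\<close> gives the same relation for \<open>c a\<close> and \<open>c b\<close>, up to a square.
\<close>

lemma sc_add:
  assumes "u \<in> carrier W" "a \<noteq> 0" "b \<noteq> 0" "a + b \<noteq> 0"
  shows "sc a u \<otimes>\<^bsub>W\<^esub> sc b u = sc (a + b) u \<otimes>\<^bsub>W\<^esub> sc ((a + b) * a * b) u"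
  using assms(1)
proof (induction u rule: W_induct)
  case zero
  show ?case using assms by simp
next
  case (add z u)
  have abc: "(a + b) * a * b \<noteq> 0" using assms by simp
  have d: "a * z + b * z = (a + b) * z" by (simp add: algebra_simps)
  have "rank_one (a * z) \<otimes>\<^bsub>W\<^esub> rank_one (b * z)
      = rank_one ((a + b) * z) \<otimes>\<^bsub>W\<^esub> rank_one ((a + b) * z * (a * z) * (b * z))"
    using rank_one_add[of "a * z" "b * z", unfolded d] assms add.hyps by simp
  also have "(a + b) * z * (a * z) * (b * z) = z * z * ((a + b) * a * b * z)" by (simp add: algebra_simps)
  also have "rank_one \<dots> = rank_one ((a + b) * a * b * z)"
    using sc_square[OF rank_one_closed[of "(a + b) * a * b * z"], of z] sc_rank_one[of "(a + b) * a * b * z" "z * z"]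
      add.hyps abc by simp
  finally have 1: "sc a (rank_one z) \<otimes>\<^bsub>W\<^esub> sc b (rank_one z)
      = sc (a + b) (rank_one z) \<otimes>\<^bsub>W\<^esub> sc ((a + b) * a * b) (rank_one z)"
    using sc_rank_one[OF add.hyps(1)] assms abc by simp
  note cl = rank_one_closed[OF add.hyps(1)] add.hyps(2)
  have "sc a (rank_one z \<otimes>\<^bsub>W\<^esub> u) \<otimes>\<^bsub>W\<^esub> sc b (rank_one z \<otimes>\<^bsub>W\<^esub> u)
      = (sc a (rank_one z) \<otimes>\<^bsub>W\<^esub> sc b (rank_one z)) \<otimes>\<^bsub>W\<^esub> (sc a u \<otimes>\<^bsub>W\<^esub> sc b u)"
    using cl assms by (simp add: sc_mult sc_closed W.m_ac)
  also have "\<dots> = (sc (a + b) (rank_one z) \<otimes>\<^bsub>W\<^esub> sc ((a + b) * a * b) (rank_one z))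
      \<otimes>\<^bsub>W\<^esub> (sc (a + b) u \<otimes>\<^bsub>W\<^esub> sc ((a + b) * a * b) u)"
    using 1 add.IH by simp
  also have "\<dots> = sc (a + b) (rank_one z \<otimes>\<^bsub>W\<^esub> u) \<otimes>\<^bsub>W\<^esub> sc ((a + b) * a * b) (rank_one z \<otimes>\<^bsub>W\<^esub> u)"
    using cl assms abc by (simp add: sc_mult sc_closed W.m_ac del: mult_eq_0_iff)
  finally show ?case .
qed

text \<open>
  With the value zero in negative degrees, the recursion over two entries has the same form in every
  degree \<open>k\<close>.
\<close>

definition esym_lower :: "nat \<Rightarrow> nat \<Rightarrow> 'a::field list \<Rightarrow> 'a mat set" where
  "esym_lower j k xs = (if j \<le> k then esym (k - j) xs else \<one>\<^bsub>W\<^esub>)"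

lemma esym_lower_closed [simp]: "units xs \<Longrightarrow> esym_lower j k xs \<in> carrier W"
  by (simp add: esym_lower_def)

lemma esym_Cons_Cons:
  assumes "x \<noteq> 0" "y \<noteq> 0" "units xs"
  shows "esym k (x # y # xs) = esym k xs \<otimes>\<^bsub>W\<^esub> (sc x (esym_lower 1 k xs) \<otimes>\<^bsub>W\<^esub> sc y (esym_lower 1 k xs))
    \<otimes>\<^bsub>W\<^esub> sc (x * y) (esym_lower 2 k xs)"
proof -
  consider "k = 0" | "k = 1" | l where "k = Suc (Suc l)"
    by (metis One_nat_def not0_implies_Suc)
  then show ?thesis
  proof cases
    case 3
    have "esym k (x # y # xs) = (esym k xs \<otimes>\<^bsub>W\<^esub> sc y (esym (Suc l) xs))
        \<otimes>\<^bsub>W\<^esub> (sc x (esym (Suc l) xs) \<otimes>\<^bsub>W\<^esub> sc (x * y) (esym l xs))"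
      using assms 3 by (simp add: sc_mult sc_closed sc_sc)
    then show ?thesis
      using assms 3 by (simp add: esym_lower_def sc_closed W.m_ac)
  qed (use assms in \<open>auto simp: esym_lower_def sc_closed rank_one_closed W.m_ac\<close>)
qed

text \<open>
  Equality of the generating functions \<open>\<Prod> (1 + \<langle>x\<rangle> t)\<close> of two lists.
\<close>

definition esym_eq :: "'a::field list \<Rightarrow> 'a list \<Rightarrow> bool" where
  "esym_eq xs ys \<longleftrightarrow> (\<forall>k. esym k xs = esym k ys)"

lemma esym_eq_refl [simp]: "esym_eq xs xs"
  by (simp add: esym_eq_def)

lemma esym_eq_sym: "esym_eq xs ys \<Longrightarrow> esym_eq ys xs"
  by (simp add: esym_eq_def)

lemma esym_eq_trans [trans]: "esym_eq xs ys \<Longrightarrow> esym_eq ys zs \<Longrightarrow> esym_eq xs zs"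
  by (simp add: esym_eq_def)

lemma esym_eq_Cons:
  assumes "esym_eq xs ys"
  shows "esym_eq (x # xs) (x # ys)"
proof -
  have "esym k (x # xs) = esym k (x # ys)" for k
    using assms by (cases k) (simp_all add: esym_eq_def)
  then show ?thesis by (simp add: esym_eq_def)
qed

lemma esym_eq_append: "esym_eq xs ys \<Longrightarrow> esym_eq (zs @ xs) (zs @ ys)"
  by (induction zs) (simp_all add: esym_eq_Cons)

lemma esym_eq_swap:
  assumes "x \<noteq> 0" "y \<noteq> 0" "units xs"
  shows "esym_eq (x # y # xs) (y # x # xs)"
  using assms by (simp add: esym_eq_def esym_Cons_Cons sc_closed W.m_ac mult.commute)

lemma esym_eq_move: "units (x # xs @ ys) \<Longrightarrow> esym_eq (xs @ x # ys) (x # xs @ ys)"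
proof (induction xs)
  case (Cons a xs)
  then have "esym_eq (a # xs @ x # ys) (a # x # xs @ ys)"
    by (simp add: esym_eq_Cons)
  also have "esym_eq \<dots> (x # a # xs @ ys)"
    using Cons.prems by (intro esym_eq_swap) auto
  finally show ?case by simp
qed simp

lemma esym_eq_mset:
  assumes "mset xs = mset ys" "units xs"
  shows "esym_eq xs ys"
  using assms
proof (induction xs arbitrary: ys)
  case (Cons x xs)
  have set: "set (x # xs) = set ys" using mset_eq_setD[OF Cons.prems(1)] .
  then obtain as bs where ys: "ys = as @ x # bs" using split_list[of x ys] by auto
  then have "mset xs = mset (as @ bs)" using Cons.prems(1) by simp
  then have "esym_eq (x # xs) (x # as @ bs)"
    using Cons by (intro esym_eq_Cons Cons.IH) auto
  also have "esym_eq \<dots> ys"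
    unfolding ys using set Cons.prems(2) ys by (intro esym_eq_sym[OF esym_eq_move]) auto
  finally show ?case .
qed simp

lemma esym_eq_square:
  assumes "x \<noteq> 0" "c \<noteq> 0" "units xs"
  shows "esym_eq (x # xs) (x * (c * c) # xs)"
proof -
  have "sc (x * (c * c)) u = sc x u" if "u \<in> carrier W" for u
    using sc_sc[OF that, of x "c * c"] sc_square[OF that assms(2)] assms by simp
  then have "esym k (x # xs) = esym k (x * (c * c) # xs)" for k
    using assms by (cases k) simp_all
  then show ?thesis by (simp add: esym_eq_def)
qed

text \<open>
  The linear terms of \<open>(1 + \<langle>a\<rangle> t) (1 + \<langle>b\<rangle> t)\<close> agree by the relation in the Witt group.  The quadratic
  terms agree because \<open>(a + b) (a + b) a b\<close> differs from \<open>a b\<close> by a square.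
\<close>

lemma esym_eq_add:
  assumes "a \<noteq> 0" "b \<noteq> 0" "a + b \<noteq> 0" "units xs"
  shows "esym_eq (a # b # xs) ((a + b) # (a + b) * a * b # xs)"
proof -
  have "sc ((a + b) * ((a + b) * a * b)) u = sc (a * b) u" if "u \<in> carrier W" for u
    using sc_sc[OF that, of "(a + b) * (a + b)" "a * b"] sc_square[OF sc_closed[OF that], of "a * b" "a + b"] assms
    by (simp add: mult.assoc)
  moreover have "(a + b) * a * b \<noteq> 0" using assms by simp
  ultimately have "esym k (a # b # xs) = esym k ((a + b) # (a + b) * a * b # xs)" for k
    using assms esym_Cons_Cons[OF assms(1,2,4), of k] esym_Cons_Cons[of "a + b" "(a + b) * a * b" xs k]
      sc_add[OF esym_lower_closed[OF assms(4)] assms(1-3), of 1 k]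
    by (simp only: esym_lower_closed simp_thms)
  then show ?thesis by (simp add: esym_eq_def)
qed

text \<open>
  The generating function of a hyperbolic plane \<open>\<langle>c\<rangle> + \<langle>-c\<rangle>\<close> is \<open>(1 + \<langle>c\<rangle> t) (1 + \<langle>-c\<rangle> t) = 1 - t\<^sup>2\<close>.
\<close>

lemma esym_hyperbolic:
  assumes "c \<noteq> 0" "units xs"
  shows "esym k (c # - c # xs) = esym k xs \<otimes>\<^bsub>W\<^esub> inv\<^bsub>W\<^esub> esym_lower 2 k xs"
proof -
  define u where "u = esym_lower 2 k xs"
  have u: "u \<in> carrier W" using assms(2) by (simp add: u_def)
  have cl: "sc (- (c * c)) u \<in> carrier W" using sc_closed[OF u] assms(1) by simp
  have "u \<otimes>\<^bsub>W\<^esub> sc (- (c * c)) u = \<one>\<^bsub>W\<^esub>"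
    using sc_uminus[OF u, of "c * c"] sc_square[OF u assms(1)] assms(1) by simp
  then have "inv\<^bsub>W\<^esub> u = sc (- (c * c)) u"
    by (intro W.inv_equality[OF _ u cl]) (simp only: W.m_comm[OF cl u])
  then show ?thesis
    using assms esym_Cons_Cons[of c "- c" xs k] sc_uminus[of "esym_lower 1 k xs" c]
    by (simp add: u_def)
qed

lemma esym_eq_hyperbolic:
  assumes "c \<noteq> 0" "units xs"
  shows "esym_eq (c # - c # xs) (1 # - 1 # xs)"
  using assms by (simp add: esym_eq_def esym_hyperbolic del: esym.simps)

lemma esym_Suc_0_append:
  "units (xs @ ys) \<Longrightarrow> esym (Suc 0) (xs @ ys) = esym (Suc 0) xs \<otimes>\<^bsub>W\<^esub> esym (Suc 0) ys"
  by (induction xs) (simp_all add: sc_rank_one rank_one_closed W.m_ac)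

lemma esym_Suc_0_uminus:
  "units xs \<Longrightarrow> esym (Suc 0) xs \<otimes>\<^bsub>W\<^esub> esym (Suc 0) (map uminus xs) = \<one>\<^bsub>W\<^esub>"
proof (induction xs)
  case (Cons x xs)
  have "rank_one x \<otimes>\<^bsub>W\<^esub> rank_one (- x) = \<one>\<^bsub>W\<^esub>"
    using sc_uminus[of "rank_one 1" x] Cons.prems by (simp add: rank_one_closed sc_rank_one)
  moreover have "esym (Suc 0) (x # xs) \<otimes>\<^bsub>W\<^esub> esym (Suc 0) (map uminus (x # xs))
    = (esym (Suc 0) xs \<otimes>\<^bsub>W\<^esub> esym (Suc 0) (map uminus xs)) \<otimes>\<^bsub>W\<^esub> (rank_one x \<otimes>\<^bsub>W\<^esub> rank_one (- x))"
    using Cons.prems by (simp add: sc_rank_one rank_one_closed W.m_ac image_iff)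
  ultimately show ?case using Cons by simp
qed simp

lemma exists_esym_Suc_0:
  assumes "u \<in> carrier W"
  obtains xs where "units xs" "esym (Suc 0) xs = u"
proof -
  have "\<exists>xs. units xs \<and> esym (Suc 0) xs = u"
    using assms
  proof (induction u rule: W_induct)
    case zero
    show ?case by (rule exI[of _ "[]"]) simp
  next
    case (add a u)
    then obtain xs where "units xs" "esym (Suc 0) xs = u" by blast
    then show ?case
      using add.hyps by (intro exI[of _ "a # xs"]) (simp add: sc_rank_one rank_one_closed W.m_comm)
  qed
  then show thesis using that by blast
qed

section \<open>Diagonal forms that vanish in the Witt group\<close>

fun diag_form :: "'a::field list \<Rightarrow> 'a mat" where
  "diag_form [] = 0\<^sub>m 0 0"
| "diag_form (x # xs) = orth_sum (mat1 x) (diag_form xs)"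

lemma diag_form_carrier: "diag_form xs \<in> carrier_mat (length xs) (length xs)"
proof (induction xs)
  case (Cons x xs)
  show ?case using orth_sum_carrier[OF _ Cons.IH, of "mat1 x" 1 1] by simp
qed simp

lemma diag_form_sym_forms: "units xs \<Longrightarrow> diag_form xs \<in> sym_forms"
  by (induction xs) (auto intro: metabolic_sym_forms[OF metabolic_zero] orth_sum_sym_forms mat1_sym_forms simp del: One_nat_def)

lemma witt_class_diag_form: "units xs \<Longrightarrow> witt_class (diag_form xs) = esym (Suc 0) xs"
proof (induction xs)
  case (Cons x xs)
  then have x: "x \<noteq> 0" "units xs" by auto
  have "witt_class (diag_form (x # xs)) = rank_one x \<otimes>\<^bsub>W\<^esub> witt_class (diag_form xs)"
    unfolding rank_one_def mult_W[OF mat1_sym_forms[OF x(1)] diag_form_sym_forms[OF x(2)]] by simp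
  then show ?case
    using Cons.IH[OF x(2)] x by (simp add: sc_rank_one rank_one_closed W.m_comm)
qed (simp add: one_W)

text \<open>
  The entries at which a vector vanishes are collected in \<open>vs\<close>; the others, multiplied by squares,
  form \<open>us\<close>, so that the value of the quadratic form becomes a plain sum.
\<close>

lemma diag_form_value:
  assumes "units xs" "v \<in> carrier_vec (length xs)"
  shows "\<exists>us vs. units (us @ vs) \<and> sum_list us = bil (diag_form xs) v v \<and> esym_eq xs (us @ vs)
    \<and> length (us @ vs) = length xs \<and> (v \<noteq> 0\<^sub>v (length xs) \<longrightarrow> us \<noteq> [])"
  using assms
proof (induction xs arbitrary: v)
  case Nil
  then show ?case by (intro exI[of _ "[]"]) (auto simp: scalar_prod_def)
next
  case (Cons x xs)
  obtain v1 v2 where v: "v1 \<in> carrier_vec 1" "v2 \<in> carrier_vec (length xs)" "v = v1 @\<^sub>v v2"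
    using carrier_vec_append_cases[of v 1 "length xs"] Cons.prems(2) by auto
  obtain us vs where uv: "units (us @ vs)" "sum_list us = bil (diag_form xs) v2 v2"
    "esym_eq xs (us @ vs)" "length (us @ vs) = length xs" "v2 \<noteq> 0\<^sub>v (length xs) \<longrightarrow> us \<noteq> []"
    using Cons.IH[OF _ v(2)] Cons.prems(1) by auto
  define c where "c = v1 $ 0"
  have x: "x \<noteq> 0" using Cons.prems(1) by auto
  have val: "bil (diag_form (x # xs)) v v = x * (c * c) + sum_list us"
  proof -
    have "bil (diag_form (x # xs)) v v = bil (mat1 x) v1 v1 + bil (diag_form xs) v2 v2"
      unfolding v(3) diag_form.simps by (rule bil_orth_sum[OF _ diag_form_carrier v(1,1,2,2)]) simp
    also have "bil (mat1 x) v1 v1 = x * (c * c)" using v(1) by (simp add: scalar_prod_def c_def)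
    finally show ?thesis using uv(2) by simp
  qed
  show ?case
  proof (cases "c = 0")
    case True
    have "v1 = 0\<^sub>v 1" using v(1) True by (intro eq_vecI) (auto simp: c_def)
    moreover have "0\<^sub>v 1 @\<^sub>v 0\<^sub>v (length xs) = (0\<^sub>v (length (x # xs)) :: 'a vec)"
      by (rule eq_vecI) auto
    ultimately have "us \<noteq> []" if "v \<noteq> 0\<^sub>v (length (x # xs))"
      using that uv(5) v(3) by metis
    moreover have "esym_eq (x # xs) (us @ x # vs)"
      using esym_eq_trans[OF esym_eq_Cons[OF uv(3)] esym_eq_sym[OF esym_eq_move]] uv(1) x by simp
    ultimately show ?thesis
      using True val uv x by (intro exI[of _ us] exI[of _ "x # vs"]) auto
  next
    case False
    have "esym_eq (x # xs) (x * (c * c) # xs)"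
      using esym_eq_square[OF x False] Cons.prems(1) by simp
    then have "esym_eq (x # xs) ((x * (c * c) # us) @ vs)"
      using esym_eq_trans esym_eq_Cons[OF uv(3), of "x * (c * c)"] by fastforce
    then show ?thesis
      using False val uv x by (intro exI[of _ "x * (c * c) # us"] exI[of _ vs]) auto
  qed
qed

text \<open>
  Two entries \<open>a\<close> and \<open>b\<close> of \<open>us\<close> either have sum zero, and then they are the hyperbolic plane that is
  sought, or they can be replaced by \<open>a + b\<close> and an entry outside \<open>us\<close>, which makes \<open>us\<close> shorter
  without changing its sum.
\<close>

lemma esym_eq_hyperbolic_if_sum_zero:
  assumes "us \<noteq> []" "units (us @ vs)" "sum_list us = 0"
  shows "\<exists>c ys. c \<noteq> 0 \<and> units ys \<and> length ys + 2 = length (us @ vs) \<and> esym_eq (us @ vs) (c # - c # ys)"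
  using assms
proof (induction "length us" arbitrary: us vs rule: less_induct)
  case less
  obtain a us1 where us1: "us = a # us1" using less.prems(1) by (cases us) auto
  moreover have "us1 \<noteq> []" using less.prems us1 by auto
  ultimately obtain b us2 where us: "us = a # b # us2" by (cases us1) auto
  then have ab: "a \<noteq> 0" "b \<noteq> 0" "units (us2 @ vs)" using less.prems(2) by auto
  show ?case
  proof (cases "a + b = 0")
    case True
    then have "b = - a" by (simp add: eq_neg_iff_add_eq_0 add.commute)
    then show ?thesis using us ab by (intro exI[of _ a] exI[of _ "us2 @ vs"]) simp
  next
    case False
    let ?us = "(a + b) # us2" and ?vs = "((a + b) * a * b) # vs"
    have "esym_eq (us @ vs) ((a + b) # ((a + b) * a * b) # us2 @ vs)"
      unfolding us using esym_eq_add[OF ab(1,2) False ab(3)] by simp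
    also have "esym_eq \<dots> (?us @ ?vs)"
      using ab False by (intro esym_eq_mset) auto
    finally have eq: "esym_eq (us @ vs) (?us @ ?vs)" .
    have "length ?us < length us" "?us \<noteq> []" "units (?us @ ?vs)" "sum_list ?us = 0"
      using us ab False less.prems(3) by (auto simp: add.assoc)
    from less.hyps[OF this] obtain c ys where "c \<noteq> 0" "units ys"
      "length ys + 2 = length (?us @ ?vs)" "esym_eq (?us @ ?vs) (c # - c # ys)" by blast
    then show ?thesis
      using esym_eq_trans[OF eq] us by (intro exI[of _ c] exI[of _ ys]) auto
  qed
qed

fun hyp :: "nat \<Rightarrow> 'a::field list" where
  "hyp 0 = []"
| "hyp (Suc r) = 1 # - 1 # hyp r"

lemma units_hyp [simp]: "units (hyp r)"
  by (induction r) auto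

text \<open>
  The form vanishes in the Witt group, so it is isotropic.  This yields a pair \<open>c, -c\<close>, and removing
  the pair leaves a shorter list that still represents zero.
\<close>

lemma esym_eq_hyp_if_zero:
  "units xs \<Longrightarrow> esym (Suc 0) xs = \<one>\<^bsub>W\<^esub> \<Longrightarrow> \<exists>r. esym_eq xs (hyp r)"
proof (induction "length xs" arbitrary: xs rule: less_induct)
  case less
  show ?case
  proof (cases "xs = []")
    case True
    then show ?thesis by (intro exI[of _ 0]) simp
  next
    case False
    have A: "diag_form xs \<in> sym_forms" using diag_form_sym_forms[OF less.prems(1)] .
    have "witt_class (diag_form xs) = witt_class (0\<^sub>m 0 0)"
      using witt_class_diag_form[OF less.prems(1)] less.prems(2) one_W by metis
    then have "witt_equiv (diag_form xs) (0\<^sub>m 0 0)"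
      using witt_class_eq_iff[OF A metabolic_sym_forms[OF metabolic_zero]] by simp
    then obtain M M' where M: "metabolic M" "metabolic M'" "M \<in> sym_forms"
      "isometric (orth_sum (diag_form xs) M) (orth_sum (0\<^sub>m 0 0) M')"
      using witt_equivE by metis
    have "isometric M' (orth_sum (diag_form xs) M)"
      using isometric_sym_forms_sym[OF M(4) orth_sum_sym_forms[OF A M(3)]] by simp
    then have "metabolic (orth_sum (diag_form xs) M)" by (rule metabolic_isometric[OF M(2)])
    then obtain v where v: "v \<in> carrier_vec (length xs)" "v \<noteq> 0\<^sub>v (length xs)" "bil (diag_form xs) v v = 0"
      using isotropic_if_stably_metabolic[OF A diag_form_carrier _ M(1)] False by blast
    obtain us vs where uv: "units (us @ vs)" "sum_list us = 0" "esym_eq xs (us @ vs)"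
      "length (us @ vs) = length xs" "us \<noteq> []"
      using diag_form_value[OF less.prems(1) v(1)] v(2,3) by auto
    obtain c ys where ys: "c \<noteq> 0" "units ys" "length ys + 2 = length (us @ vs)"
      "esym_eq (us @ vs) (c # - c # ys)"
      using esym_eq_hyperbolic_if_sum_zero[OF uv(5,1,2)] by blast
    have eq: "esym_eq xs (c # - c # ys)" using esym_eq_trans[OF uv(3) ys(4)] .
    have "esym (Suc 0) xs = esym (Suc 0) ys"
      using eq ys(1,2) esym_hyperbolic[OF ys(1,2), of "Suc 0"] by (simp add: esym_eq_def esym_lower_def)
    then obtain r where r: "esym_eq ys (hyp r)"
      using less.hyps[of ys] ys(2,3) uv(4) less.prems(2) by auto
    have "esym_eq xs (c # - c # hyp r)"
      using esym_eq_trans[OF eq esym_eq_Cons[OF esym_eq_Cons[OF r]]] .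
    also have "esym_eq \<dots> (hyp (Suc r))"
      using esym_eq_hyperbolic[OF ys(1)] by simp
    finally show ?thesis by blast
  qed
qed

text \<open>
  Both \<open>xs + (-ys)\<close> and \<open>ys + (-ys)\<close> vanish, so \<open>xs + (-ys) + ys\<close> can be read in two ways.
\<close>

lemma esym_eq_up_to_hyp:
  assumes "units xs" "units ys" "esym (Suc 0) xs = esym (Suc 0) ys"
  shows "\<exists>r s. esym_eq (hyp r @ xs) (hyp s @ ys)"
proof -
  let ?ns = "map uminus ys"
  have ns: "units ?ns" using assms(2) by auto
  have "esym (Suc 0) (xs @ ?ns) = \<one>\<^bsub>W\<^esub>" "esym (Suc 0) (ys @ ?ns) = \<one>\<^bsub>W\<^esub>"
    using assms ns esym_Suc_0_append[of xs ?ns] esym_Suc_0_append[of ys ?ns] esym_Suc_0_uminus[OF assms(2)]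
    by simp_all
  then obtain r s where rs: "esym_eq (xs @ ?ns) (hyp s)" "esym_eq (ys @ ?ns) (hyp r)"
    using esym_eq_hyp_if_zero[of "xs @ ?ns"] esym_eq_hyp_if_zero[of "ys @ ?ns"] assms ns by auto
  have "esym_eq (hyp r @ xs) (xs @ hyp r)"
    using assms by (intro esym_eq_mset) auto
  also have "esym_eq \<dots> (xs @ ys @ ?ns)"
    by (intro esym_eq_append esym_eq_sym[OF rs(2)])
  also have "esym_eq \<dots> (ys @ xs @ ?ns)"
    using assms ns by (intro esym_eq_mset) auto
  also have "esym_eq \<dots> (ys @ hyp s)"
    by (intro esym_eq_append rs(1))
  also have "esym_eq \<dots> (hyp s @ ys)"
    using assms by (intro esym_eq_mset) auto
  finally show ?thesis by blast
qed

section \<open>The successive quotients\<close>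

lemma hom_finprod:
  assumes "comm_group G" "comm_group H" "h \<in> hom G H" "f \<in> I \<rightarrow> carrier G"
  shows "h (finprod G f I) = finprod H (\<lambda>i. h (f i)) I"
proof -
  interpret G: comm_group G by fact
  interpret H: comm_group H by fact
  have one: "h \<one>\<^bsub>G\<^esub> = \<one>\<^bsub>H\<^esub>" using hom_one[OF assms(3) G.is_group H.is_group] .
  show ?thesis
    using assms(4)
  proof (induction I rule: infinite_finite_induct)
    case (insert i I)
    then have "f i \<in> carrier G" "f \<in> I \<rightarrow> carrier G" by auto
    moreover from this have "h (f i) \<in> carrier H" "(\<lambda>i. h (f i)) \<in> I \<rightarrow> carrier H"
      using hom_in_carrier[OF assms(3)] by auto
    ultimately show ?case
      using insert by (simp add: hom_mult[OF assms(3)])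
  qed (simp_all add: one)
qed

text \<open>
  The conditions under which the quotient that replaces cosets by their unions is isomorphic to the
  usual one.  They pass to the quotient, which allows iteration.
\<close>

definition flat_group :: "'b set monoid \<Rightarrow> bool" where
  "flat_group G \<longleftrightarrow> comm_group G \<and> disjoint (carrier G) \<and> {} \<notin> carrier G"

lemma flat_quot:
  assumes "flat_group G" "subgroup N G"
  shows "flat_group (flat_quot G N)" and "flat_proj G N \<in> hom G (flat_quot G N)"
    and "x \<in> N \<Longrightarrow> flat_proj G N x = \<one>\<^bsub>flat_quot G N\<^esub>"
proof -
  interpret comm_group G using assms(1) by (simp add: flat_group_def)
  have N: "N \<lhd> G" using subgroup_imp_normal[OF assms(2)] .
  have d: "disjoint (carrier G)" "{} \<notin> carrier G" using assms(1) by (simp_all add: flat_group_def)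
  interpret quot: comm_group "G Mod N" by (rule abelian_FactGroup[OF assms(2)])
  note iso = flat_quot_iso[OF N d]
  have one: "\<Union> \<one>\<^bsub>G Mod N\<^esub> = \<one>\<^bsub>flat_quot G N\<^esub>"
    by (simp add: flat_quot_def image_group_def)
  have "comm_group (flat_quot G N)"
    using quot.iso_imp_img_comm_group[OF iso] one by simp
  then show "flat_group (flat_quot G N)"
    using flat_quot_disjoint[OF N d] by (simp add: flat_group_def)
  have "flat_proj G N = Union \<circ> (\<lambda>x. N #>\<^bsub>G\<^esub> x)" by (simp add: fun_eq_iff flat_proj_def)
  then show "flat_proj G N \<in> hom G (flat_quot G N)"
    using Group.hom_compose[OF normal.r_coset_hom_Mod[OF N] iso_imp_homomorphism[OF iso]] by simp
  assume "x \<in> N"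
  then have "N #>\<^bsub>G\<^esub> x = \<one>\<^bsub>G Mod N\<^esub>"
    using coset_join2[OF _ assms(2)] subgroup.mem_carrier[OF assms(2)] by (simp add: FactGroup_def)
  then show "flat_proj G N x = \<one>\<^bsub>flat_quot G N\<^esub>"
    using one by (simp add: flat_proj_def)
qed

text \<open>
  The groups and the projections from \<open>W\<close> onto them, constructed together from one list \<open>xs\<close> that
  represents \<open>d\<close>: the projection of \<open>esym (2 * m) xs\<close> is the element by which the next quotient is
  taken.
\<close>

primrec quot :: "'a::field list \<Rightarrow> nat \<Rightarrow> 'a mat set monoid \<times> ('a mat set \<Rightarrow> 'a mat set)" where
  "quot xs 0 = (W, \<lambda>u. u)"
| "quot xs (Suc m) = (let G = fst (quot xs m); p = snd (quot xs m); N = generate G {p (esym (2 * m) xs)}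
    in (flat_quot G N, \<lambda>u. flat_proj G N (p u)))"

definition quot_group :: "'a::field list \<Rightarrow> nat \<Rightarrow> 'a mat set monoid" where
  "quot_group xs m = fst (quot xs m)"

definition quot_proj :: "'a::field list \<Rightarrow> nat \<Rightarrow> 'a mat set \<Rightarrow> 'a mat set" where
  "quot_proj xs m = snd (quot xs m)"

definition quot_elem :: "'a::field list \<Rightarrow> nat \<Rightarrow> 'a mat set" where
  "quot_elem xs m = quot_proj xs m (esym (2 * m) xs)"

lemma quot_group_0: "quot_group xs 0 = W"
  by (simp add: quot_group_def)

lemma quot_group_Suc:
  "quot_group xs (Suc m) = flat_quot (quot_group xs m) (generate (quot_group xs m) {quot_elem xs m})"
  by (simp add: quot_group_def quot_elem_def quot_proj_def Let_def)

lemma quot_proj_0: "quot_proj xs 0 u = u"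
  by (simp add: quot_proj_def)

lemma quot_proj_Suc:
  "quot_proj xs (Suc m) u =
    flat_proj (quot_group xs m) (generate (quot_group xs m) {quot_elem xs m}) (quot_proj xs m u)"
  by (simp add: quot_group_def quot_elem_def quot_proj_def Let_def)

lemma iter_proj_quot: "iter_proj (quot_group xs) (quot_elem xs) m = quot_proj xs m"
proof
  show "iter_proj (quot_group xs) (quot_elem xs) m u = quot_proj xs m u" for u
    by (induction m) (simp_all add: quot_proj_0 quot_proj_Suc)
qed

lemma quot_invariant:
  assumes "units xs"
  shows "flat_group (quot_group xs m) \<and> quot_proj xs m \<in> hom W (quot_group xs m)"
proof (induction m)
  case 0
  show ?case
    using comm_group_W W_disjoint by (simp add: flat_group_def quot_group_0 quot_proj_0 hom_def)
next
  case (Suc m)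
  let ?G = "quot_group xs m" and ?N = "generate (quot_group xs m) {quot_elem xs m}"
  interpret G: comm_group ?G using Suc by (simp add: flat_group_def)
  have "quot_elem xs m \<in> carrier ?G"
    using Suc hom_in_carrier[of "quot_proj xs m" W ?G] assms by (simp add: quot_elem_def)
  then have N: "subgroup ?N ?G" by (intro G.generate_is_subgroup) simp
  have "flat_proj ?G ?N \<circ> quot_proj xs m \<in> hom W (flat_quot ?G ?N)"
    using hom_compose flat_quot(2)[OF _ N] Suc by blast
  moreover have "quot_proj xs (Suc m) = flat_proj ?G ?N \<circ> quot_proj xs m"
    by (simp add: fun_eq_iff quot_proj_Suc)
  ultimately show ?case
    using flat_quot(1)[OF _ N] Suc by (simp add: quot_group_Suc o_def)
qed

lemma comm_group_quot_group: "units xs \<Longrightarrow> comm_group (quot_group xs m)"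
  using quot_invariant by (auto simp: flat_group_def)

lemma quot_proj_hom: "units xs \<Longrightarrow> quot_proj xs m \<in> hom W (quot_group xs m)"
  using quot_invariant by blast

lemma quot_elem_closed: "units xs \<Longrightarrow> quot_elem xs m \<in> carrier (quot_group xs m)"
  unfolding quot_elem_def by (rule hom_in_carrier[OF quot_proj_hom]) simp_all

lemma quot_proj_Suc_eq_one:
  assumes "units xs" "quot_proj xs m u = quot_elem xs m"
  shows "quot_proj xs (Suc m) u = \<one>\<^bsub>quot_group xs (Suc m)\<^esub>"
proof -
  interpret G: comm_group "quot_group xs m" by (rule comm_group_quot_group[OF assms(1)])
  let ?N = "generate (quot_group xs m) {quot_elem xs m}"
  have "subgroup ?N (quot_group xs m)"
    using quot_elem_closed[OF assms(1)] by (intro G.generate_is_subgroup) simp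
  moreover have "quot_elem xs m \<in> ?N" by (rule generate.incl) simp
  ultimately show ?thesis
    unfolding quot_proj_Suc assms(2) quot_group_Suc
    using flat_quot(3) quot_invariant[OF assms(1)] by blast
qed

text \<open>
  Adding hyperbolic planes changes \<open>esym (2 m + 2)\<close> by values of \<open>esym (2 m)\<close> at lists that
  represent the same element of the Witt group.  By induction these values project to the element of
  the \<open>m\<close>-th group by which the next quotient is taken.
\<close>

lemma quot_proj_esym:
  assumes xs: "units xs"
  shows "units ys \<Longrightarrow> esym (Suc 0) ys = esym (Suc 0) xs \<Longrightarrow> quot_proj xs m (esym (2 * m) ys) = quot_elem xs m"
proof (induction m arbitrary: ys)
  case 0
  then show ?case by (simp add: quot_elem_def)
next
  case (Suc m)
  let ?k = "2 * Suc m" and ?p = "quot_proj xs (Suc m)"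
  interpret G: comm_group "quot_group xs (Suc m)" by (rule comm_group_quot_group[OF xs])
  note hom = quot_proj_hom[OF xs, of "Suc m"] and IH = Suc.IH
  have hyp: "esym (Suc 0) (hyp r @ zs) = esym (Suc 0) xs \<and> ?p (esym ?k (hyp r @ zs)) = ?p (esym ?k zs)"
    if "units zs" "esym (Suc 0) zs = esym (Suc 0) xs" for r zs
  proof (induction r)
    case 0
    then show ?case using that by simp
  next
    case (Suc r)
    let ?ws = "hyp r @ zs"
    have ws: "units ?ws" using that by simp
    have "esym (Suc 0) (1 # - 1 # ?ws) = esym (Suc 0) ?ws"
      using esym_hyperbolic[of 1 ?ws "Suc 0"] ws by (simp add: esym_lower_def del: esym.simps)
    moreover have "?p (esym ?k (1 # - 1 # ?ws)) = ?p (esym ?k ?ws)"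
    proof -
      have "?p (esym (2 * m) ?ws) = \<one>\<^bsub>quot_group xs (Suc m)\<^esub>"
        using quot_proj_Suc_eq_one[OF xs IH[OF ws]] Suc.IH by simp
      then have one: "?p (inv\<^bsub>W\<^esub> esym (2 * m) ?ws) = \<one>\<^bsub>quot_group xs (Suc m)\<^esub>"
        using group_hom.hom_inv[of W "quot_group xs (Suc m)" ?p "esym (2 * m) ?ws"] hom ws
        by (simp add: group_hom_def group_hom_axioms_def W.is_group G.is_group)
      have "esym ?k (1 # - 1 # ?ws) = esym ?k ?ws \<otimes>\<^bsub>W\<^esub> inv\<^bsub>W\<^esub> esym (2 * m) ?ws"
        using esym_hyperbolic[of 1 ?ws ?k] ws by (simp add: esym_lower_def del: esym.simps)
      then show ?thesis
        using one hom_mult[OF hom] hom_in_carrier[OF hom] ws by (simp del: esym.simps)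
    qed
    ultimately show ?case using Suc.IH by (simp del: esym.simps)
  qed
  obtain r s where "esym_eq (hyp r @ ys) (hyp s @ xs)"
    using esym_eq_up_to_hyp[OF Suc.prems(1) xs Suc.prems(2)] by blast
  then have "?p (esym ?k ys) = ?p (esym ?k xs)"
    using hyp[OF Suc.prems, of r] hyp[OF xs refl, of s] by (simp add: esym_eq_def del: esym.simps)
  then show ?case unfolding quot_elem_def .
qed

section \<open>Symmetric functions as sums over subsets\<close>

text \<open>
  The subsets of \<open>{1..n + 1}\<close> are divided into those without \<open>n + 1\<close> and those with it, which
  correspond to the two terms in the recursion for \<open>esym\<close>.  The list is reversed because that recursion
  removes the first entry, here \<open>a (n + 1)\<close>.
\<close>

lemma esym_eq_finprod:
  fixes a :: "nat \<Rightarrow> 'a::field"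
  assumes "\<forall>i\<in>{1..n}. a i \<noteq> 0"
  shows "esym k (map a (rev [1..<Suc n])) = finprod W (\<lambda>I. rank_one (\<Prod>i\<in>I. a i)) {I. I \<subseteq> {1..n} \<and> card I = k}"
  using assms
proof (induction n arbitrary: k)
  case 0
  have S: "{I. I \<subseteq> {1..0::nat} \<and> card I = k} = (if k = 0 then {{}} else {})" by auto
  show ?case unfolding S by (cases k) (simp_all add: rank_one_closed)
next
  case (Suc n)
  let ?f = "\<lambda>I. rank_one (\<Prod>i\<in>I. a i)"
  let ?S = "\<lambda>n k. {I. I \<subseteq> {1..n::nat} \<and> card I = k}"
  have nz: "(\<Prod>i\<in>I. a i) \<noteq> 0" if "I \<subseteq> {1..Suc n}" for I
    using Suc.prems that finite_subset[OF that] by auto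
  have cl: "?f I \<in> carrier W" if "I \<subseteq> {1..Suc n}" for I
    using rank_one_closed[OF nz[OF that]] .
  have an: "a (Suc n) \<noteq> 0" using Suc.prems by auto
  have fin: "finite (?S l k)" for l k by simp
  show ?case
  proof (cases k)
    case 0
    have "?S (Suc n) 0 = {{}}" using finite_subset by fastforce
    then show ?thesis using 0 by (simp add: rank_one_closed)
  next
    case (Suc j)
    have sub: "I \<subseteq> {1..Suc n}" if "I \<subseteq> {1..n}" for I :: "nat set" using that by fastforce
    have notin: "Suc n \<notin> I" "finite I" if "I \<subseteq> {1..n}" for I :: "nat set"
      using that finite_subset[OF that] by auto
    have split: "?S (Suc n) (Suc j) = ?S n (Suc j) \<union> insert (Suc n) ` ?S n j"
    proof (intro equalityI subsetI)
      fix I assume I: "I \<in> ?S (Suc n) (Suc j)"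
      then have "finite I" using finite_subset by blast
      show "I \<in> ?S n (Suc j) \<union> insert (Suc n) ` ?S n j"
      proof (cases "Suc n \<in> I")
        case True
        have "I - {Suc n} \<in> ?S n j" using I True \<open>finite I\<close> by (auto simp: le_Suc_eq)
        moreover have "I = insert (Suc n) (I - {Suc n})" using True by blast
        ultimately show ?thesis by blast
      next
        case False
        then have "I \<subseteq> {1..n}" using I by (fastforce simp: le_Suc_eq)
        then show ?thesis using I by simp
      qed
    next
      fix I assume "I \<in> ?S n (Suc j) \<union> insert (Suc n) ` ?S n j"
      then show "I \<in> ?S (Suc n) (Suc j)" using sub notin by fastforce
    qed
    have inj: "inj_on (insert (Suc n)) (?S n j)"
      using notin by (intro inj_onI) (metis (mono_tags, lifting) insert_ident mem_Collect_eq)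
    have "finprod W ?f (?S (Suc n) (Suc j))
        = finprod W ?f (?S n (Suc j)) \<otimes>\<^bsub>W\<^esub> finprod W ?f (insert (Suc n) ` ?S n j)"
      unfolding split using cl sub notin(1) by (intro W.finprod_Un_disjoint) (auto intro!: cl)
    also have "finprod W ?f (insert (Suc n) ` ?S n j) = finprod W (\<lambda>I. ?f (insert (Suc n) I)) (?S n j)"
      using inj by (intro W.finprod_reindex) (auto intro!: cl)
    also have "\<dots> = finprod W (\<lambda>I. sc (a (Suc n)) (?f I)) (?S n j)"
    proof (rule W.finprod_cong')
      show "(\<lambda>I. sc (a (Suc n)) (?f I)) \<in> ?S n j \<rightarrow> carrier W"
        using sc_closed[OF cl an] sub by auto
      fix I assume "I \<in> ?S n j"
      then show "?f (insert (Suc n) I) = sc (a (Suc n)) (?f I)"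
        using sc_rank_one[OF nz an] sub notin by simp
    qed simp
    also have "\<dots> = sc (a (Suc n)) (finprod W ?f (?S n j))"
      using hom_finprod[OF comm_group_W comm_group_W sc_hom[OF an], of ?f "?S n j"] cl sub by auto
    finally show ?thesis
      using Suc.IH[of "Suc j"] Suc.IH[of j] Suc.prems \<open>k = Suc j\<close> by simp
  qed
qed

lemma esym_Suc_0_eq_finsum:
  fixes a :: "nat \<Rightarrow> 'a::field"
  assumes "\<forall>i\<in>{1..n}. a i \<noteq> 0"
  shows "esym (Suc 0) (map a (rev [1..<Suc n])) = finsum witt_ring (\<lambda>i. rank_one (a i)) {1..n}"
proof -
  have "esym (Suc 0) (map a (rev [1..<Suc n])) = finprod W (\<lambda>i. rank_one (a i)) {1..n}"
    using assms
  proof (induction n)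
    case (Suc n)
    have "{1..Suc n} = insert (Suc n) {1..n}" by auto
    then show ?case
      using Suc by (simp add: sc_rank_one rank_one_closed W.m_comm)
  qed simp
  then show ?thesis by (simp add: finsum_def W_def)
qed

lemma units_map_upt:
  "\<forall>i\<in>{1..n}. a i \<noteq> 0 \<Longrightarrow> units (map a (rev [1..<Suc n]))"
  by force

lemma iter_proj_cong:
  "(\<And>i. i < m \<Longrightarrow> Q i = Q' i \<and> s i = s' i) \<Longrightarrow> iter_proj Q s m = iter_proj Q' s' m"
  by (induction m) (simp_all add: fun_eq_iff)

(* Q m and s m stand for Q_{d,k} and Sigma_k(d) with k = 2 * m.  The groups Q m are in multiplicative
   notation, so finprod (Q m) is the sum in Q_{d,k}. *)
theorem mainTheorem2:
  fixes d :: "'a::field mat set"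
  assumes "perfect_field TYPE('a)"
    and "d \<in> carrier witt_ring"
  shows "\<exists>!(Q :: nat \<Rightarrow> 'a mat set monoid, s :: nat \<Rightarrow> 'a mat set).
      (\<forall>m. comm_group (Q m) \<and> s m \<in> carrier (Q m)) \<and>
      Q 0 = add_monoid witt_ring \<and>
      s 0 = \<one>\<^bsub>witt_ring\<^esub> \<and>
      (\<forall>m. Q (Suc m) = flat_quot (Q m) (generate (Q m) {s m})) \<and>
      (\<forall>m n. \<forall>a :: nat \<Rightarrow> 'a.
         (\<forall>i\<in>{1..n}. a i \<noteq> 0) \<and> finsum witt_ring (\<lambda>i. rank_one (a i)) {1..n} = d \<longrightarrow>
         s (Suc m) =
           finprod (Q (Suc m)) (\<lambda>I. iter_proj Q s (Suc m) (rank_one (\<Prod>i\<in>I. a i)))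
             {I. I \<subseteq> {1..n} \<and> card I = 2 * Suc m})"
proof -
  have "d \<in> carrier W" using assms(2) by (simp add: W_def)
  then obtain xs where xs: "units xs" "esym (Suc 0) xs = d" by (rule exists_esym_Suc_0)
  have formula: "quot_elem xs (Suc m) = finprod (quot_group xs (Suc m))
      (\<lambda>I. iter_proj (quot_group xs) (quot_elem xs) (Suc m) (rank_one (\<Prod>i\<in>I. a i)))
      {I. I \<subseteq> {1..n} \<and> card I = 2 * Suc m}"
    if a: "\<forall>i\<in>{1..n}. a i \<noteq> 0" "finsum witt_ring (\<lambda>i. rank_one (a i)) {1..n} = d" for m n and a :: "nat \<Rightarrow> 'a"
  proof -
    let ?S = "{I. I \<subseteq> {1..n} \<and> card I = 2 * Suc m}"
    have "(\<lambda>I. rank_one (\<Prod>i\<in>I. a i)) \<in> ?S \<rightarrow> carrier W"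
    proof
      fix I assume "I \<in> ?S"
      then have "finite I" "\<forall>i\<in>I. a i \<noteq> 0" using a(1) finite_subset by blast+
      then show "rank_one (\<Prod>i\<in>I. a i) \<in> carrier W" by (simp add: rank_one_closed)
    qed
    then have "quot_proj xs (Suc m) (finprod W (\<lambda>I. rank_one (\<Prod>i\<in>I. a i)) ?S)
        = finprod (quot_group xs (Suc m)) (\<lambda>I. quot_proj xs (Suc m) (rank_one (\<Prod>i\<in>I. a i))) ?S"
      by (rule hom_finprod[OF comm_group_W comm_group_quot_group[OF xs(1)] quot_proj_hom[OF xs(1)]])
    moreover have "quot_elem xs (Suc m) = quot_proj xs (Suc m) (esym (2 * Suc m) (map a (rev [1..<Suc n])))"
      using quot_proj_esym[OF xs(1) units_map_upt[OF a(1)], of "Suc m"] esym_Suc_0_eq_finsum[OF a(1)] a(2) xs(2)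
      by metis
    ultimately show ?thesis
      unfolding iter_proj_quot esym_eq_finprod[OF a(1)] by simp
  qed
  have elem_0: "quot_elem xs 0 = \<one>\<^bsub>witt_ring\<^esub>"
    by (simp add: quot_elem_def quot_proj_0 one_witt_ring)
  show ?thesis
  proof (rule ex1I[of _ "(quot_group xs, quot_elem xs)"], goal_cases)
    case 1
    show ?case
      unfolding prod.case
      using comm_group_quot_group[OF xs(1)] quot_elem_closed[OF xs(1)] quot_group_0[of xs] elem_0
        quot_group_Suc[of xs] formula by (auto simp only: W_def)
  next
    case (2 Qs)
    obtain Q s where Qs: "Qs = (Q, s)" by (cases Qs)
    have Q0: "Q 0 = W" and s0: "s 0 = \<one>\<^bsub>witt_ring\<^esub>"
      and QSuc: "Q (Suc m) = flat_quot (Q m) (generate (Q m) {s m})"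
      and sSuc: "\<forall>i\<in>{1..n}. a i \<noteq> 0 \<Longrightarrow> finsum witt_ring (\<lambda>i. rank_one (a i)) {1..n} = d \<Longrightarrow>
         s (Suc m) = finprod (Q (Suc m)) (\<lambda>I. iter_proj Q s (Suc m) (rank_one (\<Prod>i\<in>I. a i)))
             {I. I \<subseteq> {1..n} \<and> card I = 2 * Suc m}" for m n and a :: "nat \<Rightarrow> 'a"
      using 2 unfolding Qs prod.case W_def by blast+
    \<comment> \<open>a single representation of \<open>d\<close> already determines every \<open>s (Suc m)\<close>\<close>
    define n where "n = length xs"
    define a where "a i = rev xs ! (i - 1)" for i
    have "map a [1..<Suc n] = rev xs"
      by (rule nth_equalityI) (auto simp: a_def n_def simp del: upt_Suc)
    then have map_a: "map a (rev [1..<Suc n]) = xs" by (metis rev_map rev_rev_ident)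
    have a: "\<forall>i\<in>{1..n}. a i \<noteq> 0"
    proof
      fix i assume "i \<in> {1..n}"
      then have "a i \<in> set (map a (rev [1..<Suc n]))" by (simp del: upt_Suc)
      then show "a i \<noteq> 0" using xs(1) map_a by metis
    qed
    have sum_a: "finsum witt_ring (\<lambda>i. rank_one (a i)) {1..n} = d"
      using esym_Suc_0_eq_finsum[OF a] map_a xs(2) by simp
    have "Q m = quot_group xs m \<and> s m = quot_elem xs m" for m
    proof (induction m rule: less_induct)
      case (less m)
      show ?case
      proof (cases m)
        case 0
        then show ?thesis using Q0 s0 quot_group_0[of xs] elem_0 by simp
      next
        case (Suc l)
        have Q: "Q (Suc l) = quot_group xs (Suc l)"
          using less[of l] Suc QSuc[of l] quot_group_Suc[of xs l] by simp
        have "iter_proj Q s (Suc l) = iter_proj (quot_group xs) (quot_elem xs) (Suc l)"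
          using less Suc by (intro iter_proj_cong) simp
        then show ?thesis
          using Q sSuc[OF a sum_a, of l] formula[OF a sum_a, of l] Suc by simp
      qed
    qed
    then show ?case unfolding Qs by (simp add: fun_eq_iff)
  qed
qed

end
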